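(* Let $s\in(0,1)$, let $\Omega\subset\mathbb{R}^d$ be a bounded Lipschitz domain that satisfies the exterior ball condition, let $\beta\in(2s,4]$ with $\beta\notin\mathbb{N}_0$ and $\beta-2s\notin\mathbb{N}_0$, and let $\eta\in\mathcal{C}(\lambda,\Lambda)$. Let $w\in\mathcal{S}^\beta(\Omega)$ (with constant $M$), let $\alpha_0>1$, $\varepsilon>0$, and let $x\in\Omega$ be such that $\delta(x)\ge\alpha_0\varepsilon$. Then $$\big|\mathcal{L}_\eta[w](x)-\mathcal{L}_{\eta,\varepsilon}[w](x)\big|\le C\,\varepsilon^{\beta-2s}\,\delta(x)^{s-\beta},$$ where the constant $C$ depends only on $d,s,\alpha_0,\beta,\lambda,\Lambda$ and on $M$ (and not on $x$ or $\varepsilon$).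
   Context: $\delta(x)=\operatorname{dist}(x,\partial\Omega)$. Functions on $\Omega$ are extended by zero outside $\Omega$. Kernel class: for $0<\lambda\le\Lambda<\infty$, $\eta\in\mathcal{C}(\lambda,\Lambda)$ means $\eta:\mathbb{S}^{d-1}\to\mathbb{R}$ satisfies $\eta(\theta)=\eta(-\theta)$ for all $\theta$ and $\lambda\le\eta(\theta)\le\Lambda$ for a.e. $\theta$. Operators: $$\mathcal{L}_\eta[w](x)=\mathrm{p.v.}\int_{\mathbb{R}^d}\frac{w(x)-w(y)}{|x-y|^{d+2s}}\,\eta\Big(\frac{x-y}{|x-y|}\Big)\,dy=\frac12\int_{\mathbb{R}^d}\big(2w(x)-w(x-y)-w(x+y)\big)\,\eta\Big(\frac{y}{|y|}\Big)\frac{dy}{|y|^{d+2s}},$$ $$\mathcal{L}_{\eta,\varepsilon}[w](x)=\frac12\int_{\mathbb{R}^d}\big(2w(x)-w(x-y)-w(x+y)\big)\,\eta\Big(\frac{y}{|y|}\Big)\mathcal{K}_\varepsilon(|y|)\,dy,$$ where $\mathcal{K}_\varepsilon(r)=r^{-d-2s}$ for $r\ge\varepsilon$ and $\mathcal{K}_\varepsilon(r)=\varepsilon^{-d-2s}+\gamma(r^2-\varepsilon^2)+\nu(r^3-\varepsilon^3)$ for $r<\varepsilon$, with $$\gamma=-\frac{(4+d)(d+2s)(3+d+2s)}{4(1-s)}\varepsilon^{-d-2s-2},\qquad \nu=\frac{(5+d)(d+2s)(2+d+2s)}{6(1-s)}\varepsilon^{-d-2s-3}.$$ (These values make $\mathcal{K}_\varepsilon\in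 C^1([0,\infty))$ and $\int_0^\varepsilon r^2\mathcal{K}_\varepsilon(r)r^{d-1}dr=\int_0^\varepsilon r^{2}r^{-d-2s}r^{d-1}dr$.) Function class: for $\beta>2s$ with $\beta,\beta-2s\notin\mathbb{N}_0$, $w\in\mathcal{S}^\beta(\Omega)$ (with constant $M$) means $w\in C^\beta(\Omega)\cap C^{0,s}(\overline\Omega)$, $\|w\|_{C^{0,s}(\overline\Omega)}\le M$, and $\|w\|_{C^\beta(\{x\in\Omega:\delta(x)\ge\rho\})}\le M\rho^{s-\beta}$ for all $\rho>0$. Here, for noninteger $\beta=k+\alpha$ with $k\in\mathbb{N}_0$, $\alpha\in(0,1)$, $C^\beta=C^{k,\alpha}$ with the usual H\"older norm, and $C^\beta(\Omega)$ means $C^\beta(\overline U)$ for every $U\Subset\Omega$. *)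

theory Defs
  imports "HOL-Analysis.Analysis"
begin

text \<open>
  \<open>\<real>\<^sup>d\<close> is an arbitrary Euclidean space \<open>'a\<close> with \<open>d = DIM('a)\<close>.
\<close>

section \<open>Domains\<close>

text \<open>Near each boundary point, \<open>\<Omega>\<close> lies above the graph of a Lipschitz function; the unit vector
  \<open>e\<close> is the vertical direction of the rotated coordinates, its orthogonal complement plays the
  role of \<open>\<real>\<^sup>d\<^sup>-\<^sup>1\<close>.\<close>

definition bounded_lipschitz_domain :: "'a::euclidean_space set \<Rightarrow> bool" where
  "bounded_lipschitz_domain \<Omega> \<longleftrightarrow>
     open \<Omega> \<and> connected \<Omega> \<and> \<Omega> \<noteq> {} \<and> bounded \<Omega> \<and>
     (\<forall>z\<in>frontier \<Omega>. \<exists>r>0. \<exists>e \<phi> L. norm e = 1 \<and> L-lipschitz_on {y. y \<bullet> e = 0} \<phi> \<and>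
        \<Omega> \<inter> ball z r = {y \<in> ball z r. y \<bullet> e > \<phi> (y - (y \<bullet> e) *\<^sub>R e)})"

definition exterior_ball_condition :: "'a::euclidean_space set \<Rightarrow> bool" where
  "exterior_ball_condition \<Omega> \<longleftrightarrow>
     (\<exists>r>0. \<forall>z\<in>frontier \<Omega>. \<exists>c. dist c z = r \<and> ball c r \<inter> \<Omega> = {})"

abbreviation bdist :: "'a::euclidean_space set \<Rightarrow> 'a \<Rightarrow> real" where
  "bdist \<Omega> x \<equiv> infdist x (frontier \<Omega>)"

definition zero_ext :: "'a set \<Rightarrow> ('a \<Rightarrow> real) \<Rightarrow> 'a \<Rightarrow> real" where
  "zero_ext \<Omega> w = (\<lambda>x. if x \<in> \<Omega> then w x else 0)"

section \<open>Kernels and operators\<close>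

text \<open>Surface measure on the unit sphere: by polar coordinates, \<open>\<sigma>(A)\<close> is \<open>d\<close> times the volume of the
  cone \<open>{y. 0 < norm y < 1, y / norm y \<in> A}\<close>.\<close>

definition sphere_measure :: "'a::euclidean_space measure" where
  "sphere_measure = scale_measure (of_nat DIM('a))
     (distr (restrict_space lborel (ball 0 1 - {0})) (restrict_space borel (sphere 0 1))
        (\<lambda>y. y /\<^sub>R norm y))"

text \<open>Functions on the sphere are total functions of which only the values on the sphere matter.\<close>

definition kernel_class :: "real \<Rightarrow> real \<Rightarrow> ('a::euclidean_space \<Rightarrow> real) set" where
  "kernel_class lam Lam =
     {\<eta>. \<eta> \<in> borel_measurable (completion sphere_measure) \<and>
         (\<forall>\<theta>\<in>sphere 0 1. \<eta> \<theta> = \<eta> (- \<theta>)) \<and>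
         (AE \<theta> in sphere_measure. lam \<le> \<eta> \<theta> \<and> \<eta> \<theta> \<le> Lam)}"

definition L_op :: "real \<Rightarrow> ('a::euclidean_space \<Rightarrow> real) \<Rightarrow> ('a \<Rightarrow> real) \<Rightarrow> 'a \<Rightarrow> real" where
  "L_op s \<eta> w x = Lim (at_right 0) (\<lambda>r.
     LINT y:{y. r < norm (x - y)}|lebesgue.
       (w x - w y) / norm (x - y) powr (real DIM('a) + 2 * s)
         * \<eta> ((x - y) /\<^sub>R norm (x - y)))"

definition reg_gamma :: "real \<Rightarrow> real \<Rightarrow> real \<Rightarrow> real" where
  "reg_gamma d s \<epsilon> =
     - ((4 + d) * (d + 2 * s) * (3 + d + 2 * s) / (4 * (1 - s))) * \<epsilon> powr (- d - 2 * s - 2)"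

definition reg_nu :: "real \<Rightarrow> real \<Rightarrow> real \<Rightarrow> real" where
  "reg_nu d s \<epsilon> =
     (5 + d) * (d + 2 * s) * (2 + d + 2 * s) / (6 * (1 - s)) * \<epsilon> powr (- d - 2 * s - 3)"

definition reg_kernel :: "real \<Rightarrow> real \<Rightarrow> real \<Rightarrow> real \<Rightarrow> real" where
  "reg_kernel d s \<epsilon> r =
     (if \<epsilon> \<le> r then r powr (- d - 2 * s)
      else \<epsilon> powr (- d - 2 * s) + reg_gamma d s \<epsilon> * (r ^ 2 - \<epsilon> ^ 2)
             + reg_nu d s \<epsilon> * (r ^ 3 - \<epsilon> ^ 3))"

definition L_eps_op ::
    "real \<Rightarrow> real \<Rightarrow> ('a::euclidean_space \<Rightarrow> real) \<Rightarrow> ('a \<Rightarrow> real) \<Rightarrow> 'a \<Rightarrow> real" where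
  "L_eps_op s \<epsilon> \<eta> w x = 1 / 2 *
     (LINT y|lebesgue. (2 * w x - w (x - y) - w (x + y))
        * \<eta> (y /\<^sub>R norm y) * reg_kernel (real DIM('a)) s \<epsilon> (norm y))"

section \<open>Hoelder spaces\<close>

fun partials :: "'a::euclidean_space list \<Rightarrow> ('a \<Rightarrow> real) \<Rightarrow> 'a \<Rightarrow> real" where
  "partials [] f = f"
| "partials (b # bs) f = (\<lambda>x. frechet_derivative (partials bs f) (at x) b)"

text \<open>Lists of basis vectors of length \<open>j\<close> stand for multi-indices of order \<open>j\<close>. For a \<open>C\<^sup>k\<close> function
  mixed partial derivatives commute, so suprema over such lists are suprema over multi-indices.\<close>

definition multi_indices :: "nat \<Rightarrow> 'a::euclidean_space list set" where
  "multi_indices j = {bs. set bs \<subseteq> Basis \<and> length bs = j}"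

text \<open>To be used for open \<open>U\<close> only.\<close>

definition Ck_on :: "nat \<Rightarrow> 'a::euclidean_space set \<Rightarrow> ('a \<Rightarrow> real) \<Rightarrow> bool" where
  "Ck_on k U f \<longleftrightarrow>
     (\<forall>j<k. \<forall>bs\<in>multi_indices j. partials bs f differentiable_on U) \<and>
     (\<forall>j\<le>k. \<forall>bs\<in>multi_indices j. continuous_on U (partials bs f))"

definition holder_seminorm :: "real \<Rightarrow> 'a::metric_space set \<Rightarrow> ('a \<Rightarrow> real) \<Rightarrow> ennreal" where
  "holder_seminorm \<alpha> D f =
     (SUP x\<in>D. SUP y\<in>D - {x}. ennreal (\<bar>f x - f y\<bar> / dist x y powr \<alpha>))"

text \<open>The norm of \<open>C\<^sup>k\<^sup>,\<^sup>\<alpha>\<close> on \<open>D\<close> for \<open>\<beta> = k + \<alpha>\<close>, with value \<open>\<infinity>\<close> allowed. If \<open>\<beta> > 1\<close>, the function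
  has to be \<open>C\<^sup>k\<close> in a neighbourhood of \<open>D\<close> for this to be meaningful.\<close>

definition holder_norm :: "real \<Rightarrow> 'a::euclidean_space set \<Rightarrow> ('a \<Rightarrow> real) \<Rightarrow> ennreal" where
  "holder_norm \<beta> D f = (let k = nat \<lfloor>\<beta>\<rfloor>; \<alpha> = frac \<beta> in
     (\<Sum>j\<le>k. SUP bs\<in>multi_indices j. SUP x\<in>D. ennreal \<bar>partials bs f x\<bar>)
     + (SUP bs\<in>multi_indices k. holder_seminorm \<alpha> D (partials bs f)))"

definition holder_loc :: "real \<Rightarrow> 'a::euclidean_space set \<Rightarrow> ('a \<Rightarrow> real) \<Rightarrow> bool" where
  "holder_loc \<beta> \<Omega> f \<longleftrightarrow>
     (\<forall>U. open U \<and> compact (closure U) \<and> closure U \<subseteq> \<Omega> \<longrightarrow>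
        Ck_on (nat \<lfloor>\<beta>\<rfloor>) U f \<and> holder_norm \<beta> (closure U) f < \<infinity>)"

text \<open>The values of \<open>w\<close> on \<open>closure \<Omega>\<close> matter; on the boundary they are those of the continuous
  extension from \<open>\<Omega>\<close>, not those of the extension by zero. The condition \<open>0 \<le> M\<close>, implied by
  \<open>norm \<le> M\<close>, is explicit because \<open>ennreal\<close> truncates negative numbers. As \<open>0 < s < 1\<close>,
  \<open>holder_norm s\<close> is the norm of \<open>C\<^sup>0\<^sup>,\<^sup>s\<close>, and its finiteness is membership in that space.\<close>

definition S_class :: "real \<Rightarrow> real \<Rightarrow> real \<Rightarrow> 'a::euclidean_space set \<Rightarrow> ('a \<Rightarrow> real) set" where
  "S_class s \<beta> M \<Omega> =
     {w. holder_loc \<beta> \<Omega> w \<and> 0 \<le> M \<and>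
         holder_norm s (closure \<Omega>) w \<le> ennreal M \<and>
         (\<forall>\<rho>>0. holder_norm \<beta> {x \<in> \<Omega>. \<rho> \<le> bdist \<Omega> x} w \<le> ennreal (M * \<rho> powr (s - \<beta>)))}"

end

theory Submission
  imports Defs
begin

text \<open>
  Both kernels agree for \<open>norm y \<ge> \<epsilon>\<close>, so the difference of the two operators is an integral of the
  second difference of \<open>w\<close> over the ball of radius \<open>\<epsilon>\<close>, which stays away from the boundary because
  \<open>\<alpha>\<^sub>0 > 1\<close>. Expand the second difference at \<open>x\<close>: odd orders cancel, and the second-order term is a
  quadratic form. Its product with the angular part of the kernel is \<open>(norm y)\<^sup>2\<close> times a function that
  is homogeneous of degree zero, so in polar coordinates its integral factors through the second moment
  of the difference of the kernels, which is zero. The remainder is at most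
  \<open>C * bdist \<Omega> x powr (s - \<beta>) * norm y powr \<beta>\<close>, and integrating it against kernels of size
  \<open>norm y powr (-d - 2 * s)\<close> and \<open>\<epsilon> powr (-d - 2 * s)\<close> gives \<open>\<epsilon> powr (\<beta> - 2 * s)\<close>.
\<close>

section \<open>Affine changes of variables\<close>

text \<open>The sphere enters only through homogeneity: if \<open>k\<close> is constant along rays,
  the mass that the density \<open>k\<close> gives to a ball of radius \<open>R\<close> is
  proportional to \<open>R ^ DIM('a)\<close>, and this fixes the image of that measure under
  \<open>norm\<close>. The resulting factor in front of the radial integral is an unspecified number
  depending on \<open>k\<close>. This does no harm: for the quadratic term it multiplies zero, and
  for the error estimate \<open>k\<close> is the constant 1, so the factor depends on the dimension
  alone and can be fixed before the domain, the kernel and the function are given. Two obstacles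
  shape the rest. \<open>\<eta>\<close> is measurable only for a completed measure and bounded only
  almost everywhere, so null sets of the sphere have to be carried over to the whole space. And
  \<open>L_op\<close> is a limit of truncated integrals of first differences, which must be
  symmetrised before the second difference, whose integral converges absolutely, can appear.\<close>

lemma
  fixes t :: "'a::euclidean_space" and c :: real
  assumes "c \<noteq> 0"
  shows lebesgue_affine_scaleR:
      "lebesgue = density (distr lebesgue lebesgue (\<lambda>x. t + c *\<^sub>R x)) (\<lambda>_. ennreal (\<bar>c\<bar> ^ DIM('a)))"
    and measurable_lebesgue_affine_scaleR: "(\<lambda>x. t + c *\<^sub>R x) \<in> lebesgue \<rightarrow>\<^sub>M lebesgue"
proof -
  have eq: "(\<Sum>j\<in>Basis. (c * (x \<bullet> j)) *\<^sub>R j) = c *\<^sub>R x" for x :: 'a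
    by (simp add: scaleR_sum_right[symmetric] euclidean_representation flip: scaleR_scaleR)
  show "lebesgue = density (distr lebesgue lebesgue (\<lambda>x. t + c *\<^sub>R x)) (\<lambda>_. ennreal (\<bar>c\<bar> ^ DIM('a)))"
    using lebesgue_affine_euclidean[of "\<lambda>_. c" t] assms by (simp add: eq)
  show "(\<lambda>x. t + c *\<^sub>R x) \<in> lebesgue \<rightarrow>\<^sub>M lebesgue"
    using lebesgue_affine_measurable[of "\<lambda>_. c" t] assms by (simp add: eq)
qed

lemma nn_integral_lebesgue_scaleR:
  fixes f :: "'a::euclidean_space \<Rightarrow> ennreal" and c :: real
  assumes f[measurable]: "f \<in> borel_measurable lebesgue" and c: "c \<noteq> 0"
  shows "(\<integral>\<^sup>+x. f x \<partial>lebesgue) = ennreal (\<bar>c\<bar> ^ DIM('a)) * (\<integral>\<^sup>+x. f (c *\<^sub>R x) \<partial>lebesgue)"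
proof -
  note [measurable] = measurable_lebesgue_affine_scaleR[OF c, of "0::'a", unfolded add_0_left]
  show ?thesis
    by (subst lebesgue_affine_scaleR[OF c, of "0::'a"])
      (simp add: nn_integral_density nn_integral_distr nn_integral_cmult)
qed

text \<open>Lebesgue measure is a positive multiple of its image under the scaling, so preimages of
  null sets are null sets.\<close>

lemma AE_lebesgue_scaleR:
  fixes c :: real
  assumes c: "c \<noteq> 0" and AE: "AE x::'a::euclidean_space in lebesgue. P x"
  shows "AE x::'a in lebesgue. P (c *\<^sub>R x)"
proof -
  note m[measurable] = measurable_lebesgue_affine_scaleR[OF c, of "0::'a", unfolded add_0_left]
  have "lebesgue = density (distr lebesgue lebesgue (\<lambda>x::'a. c *\<^sub>R x)) (\<lambda>_. ennreal (\<bar>c\<bar> ^ DIM('a)))"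
    using lebesgue_affine_scaleR[OF c, of "0::'a"] unfolding add_0_left .
  from subst[where P="\<lambda>M. almost_everywhere M P", OF this AE]
  have "AE x in density (distr lebesgue lebesgue (\<lambda>x::'a. c *\<^sub>R x)) (\<lambda>_. ennreal (\<bar>c\<bar> ^ DIM('a))). P x" .
  then have "AE x in distr lebesgue lebesgue (\<lambda>x::'a. c *\<^sub>R x). P x"
    using c by (simp add: AE_density)
  then show ?thesis by (rule AE_distrD[OF m])
qed

text \<open>The Jacobian factor is 1, so the map preserves Lebesgue measure. With
  \<open>c = -1\<close> this serves both the substitution of \<open>x - y\<close> for
  \<open>y\<close> and the symmetrisation in \<open>y\<close>.\<close>

lemma
  fixes f :: "'a::euclidean_space \<Rightarrow> 'b::{banach, second_countable_topology}"
  assumes c: "\<bar>c\<bar> = 1" and f[measurable]: "f \<in> borel_measurable lebesgue"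
  shows integral_lebesgue_reflect_shift: "(LINT y|lebesgue. f y) = (LINT y|lebesgue. f (t + c *\<^sub>R y))"
    and integrable_lebesgue_reflect_shift:
      "integrable lebesgue f \<longleftrightarrow> integrable lebesgue (\<lambda>y. f (t + c *\<^sub>R y))"
proof -
  have "c \<noteq> 0" using c by auto
  note m[measurable] = measurable_lebesgue_affine_scaleR[OF this, of t]
  have eq: "distr lebesgue lebesgue (\<lambda>x. t + c *\<^sub>R x) = lebesgue"
    using lebesgue_affine_scaleR[OF \<open>c \<noteq> 0\<close>, of t] c by (simp add: density_1)
  show "(LINT y|lebesgue. f y) = (LINT y|lebesgue. f (t + c *\<^sub>R y))"
    by (subst eq[symmetric]) (simp add: integral_distr)
  show "integrable lebesgue f \<longleftrightarrow> integrable lebesgue (\<lambda>y. f (t + c *\<^sub>R y))"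
    by (subst eq[symmetric]) (simp add: integrable_distr_eq)
qed

section \<open>Polar coordinates for functions that are homogeneous of degree zero\<close>

text \<open>Angular functions are kept on the whole space, constant along open rays with a free
  value at 0. Homogeneity holds everywhere, but the bound only almost everywhere and measurability
  only in the Lebesgue sense, because \<open>kernel_class\<close> grants no more.\<close>

definition bounded_angular :: "('a::euclidean_space \<Rightarrow> real) \<Rightarrow> real \<Rightarrow> bool" where
  "bounded_angular k B \<longleftrightarrow> k \<in> borel_measurable lebesgue \<and>
     (\<forall>t>0. \<forall>y. k (t *\<^sub>R y) = k y) \<and> (AE y in lebesgue. \<bar>k y\<bar> \<le> B)"

text \<open>For a nonnegative integrand the gauge integral is an absolutely convergent one; this
  transfers the known integrals of powers.\<close>

lemma has_bochner_integral_of_has_integral_nonneg: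
  fixes f :: "real \<Rightarrow> real"
  assumes f: "(f has_integral I) S" and nn: "\<And>x. x \<in> S \<Longrightarrow> 0 \<le> f x"
    and [measurable]: "f \<in> borel_measurable borel" "S \<in> sets borel"
  shows "has_bochner_integral lborel (\<lambda>x. indicator S x * f x) I"
proof -
  have "0 \<le> I" using f nn by (rule has_integral_nonneg)
  show ?thesis
    by (rule has_bochner_integral_nn_integral)
      (use nn_integral_has_integral_lebesgue[OF nn f] nn \<open>0 \<le> I\<close> in \<open>auto simp: indicator_def\<close>)
qed

lemma has_bochner_integral_powr_0:
  fixes a R :: real
  assumes "-1 < a" "0 \<le> R"
  shows "has_bochner_integral lborel (\<lambda>r. indicator {0..R} r * r powr a) (R powr (a + 1) / (a + 1))"
  by (rule has_bochner_integral_of_has_integral_nonneg[OF has_integral_powr_from_0]) (use assms in auto)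

lemma has_bochner_integral_powr_inf:
  fixes a R :: real
  assumes "a < -1" "0 < R"
  shows "has_bochner_integral lborel (\<lambda>r. indicator {R..} r * r powr a) (- (R powr (a + 1)) / (a + 1))"
  by (rule has_bochner_integral_of_has_integral_nonneg[OF has_integral_powr_to_inf]) (use assms in auto)

text \<open>By homogeneity the ball of radius \<open>R\<close> has mass \<open>A * R powr d\<close>,
  where \<open>A\<close> is the mass of the unit ball. The density with this distribution function
  is its derivative \<open>A * d * r powr (d - 1)\<close>, and half-lines determine a Borel measure
  on the line.\<close>

lemma angular_distr_norm:
  fixes k :: "'a::euclidean_space \<Rightarrow> real"
  assumes k: "bounded_angular k B" and nn: "\<And>y. 0 \<le> k y"
  obtains c where "0 \<le> c"
    "distr (density lebesgue (\<lambda>y. ennreal (k y))) borel norm =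
     density lborel (\<lambda>r. ennreal (c * (indicator {0<..} r * r powr (real DIM('a) - 1))))"
proof -
  have [measurable]: "k \<in> borel_measurable lebesgue"
    and hom: "\<And>t y. 0 < t \<Longrightarrow> k (t *\<^sub>R y) = k y" and AEk: "AE y in lebesgue. \<bar>k y\<bar> \<le> B"
    using k by (auto simp: bounded_angular_def)
  have [measurable]: "norm \<in> lebesgue \<rightarrow>\<^sub>M (borel :: real measure)"
    by (rule measurable_completion) simp
  have [measurable]: "ball (0::'a) r \<in> sets lebesgue" for r by simp
  define F where "F R = (\<integral>\<^sup>+y. ennreal (k y) * indicator (ball 0 R) y \<partial>lebesgue)" for R
  \<comment> \<open>Finiteness comes from the almost everywhere bound on \<open>k\<close>; it allows
    \<open>F 1\<close> to be read as a real number.\<close>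
  have "F 1 \<le> (\<integral>\<^sup>+y. ennreal B * indicator (ball (0::'a) 1) y \<partial>lebesgue)"
    unfolding F_def by (intro nn_integral_mono_AE, use AEk in eventually_elim)
      (auto intro!: mult_right_mono ennreal_leI simp: indicator_def)
  also have "\<dots> = ennreal B * emeasure lborel (ball (0::'a) 1)"
    by (simp add: nn_integral_cmult)
  also have "\<dots> < \<infinity>"
    using emeasure_lborel_ball_finite[of "0::'a" 1] by (simp add: ennreal_mult_less_top)
  finally have fin: "F 1 < \<infinity>" .
  define A where "A = enn2real (F 1)"
  have A: "F 1 = ennreal A" "0 \<le> A" using fin by (auto simp: A_def)
  define d where "d = real DIM('a)"
  have d: "0 < d" by (simp add: d_def)
  have F: "F R = ennreal (A * R powr d)" if "0 < R" for R
  proof -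
    have ind: "indicator (ball 0 R) (R *\<^sub>R x) = (indicator (ball 0 1) x :: ennreal)" for x :: 'a
      using that by (auto simp: indicator_def)
    have "F R = ennreal (R ^ DIM('a)) * (\<integral>\<^sup>+y. ennreal (k (R *\<^sub>R y)) * indicator (ball 0 R) (R *\<^sub>R y) \<partial>lebesgue)"
      unfolding F_def using that by (subst nn_integral_lebesgue_scaleR[of _ R]) auto
    also have "\<dots> = ennreal (R ^ DIM('a)) * F 1"
      unfolding F_def ind using that by (simp add: hom)
    finally show ?thesis
      using that A by (simp add: ennreal_mult'[symmetric] d_def powr_realpow mult.commute)
  qed
  define M where "M = distr (density lebesgue (\<lambda>y. ennreal (k y))) borel norm"
  define N where "N = density lborel (\<lambda>r. ennreal ((A * d) * (indicator {0<..} r * r powr (d - 1))))"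
  have M: "emeasure M {..<R} = F R" for R
  proof -
    have "norm -` {..<R} = ball (0::'a) R" by auto
    then show ?thesis unfolding M_def F_def
      by (simp add: emeasure_distr emeasure_density)
  qed
  have F0: "F R = 0" if "R \<le> 0" for R
    using that unfolding F_def by (simp add: ball_empty)
  have N: "emeasure N {..<R} = F R" for R
  proof (cases "0 < R")
    case False
    have "emeasure N {..<R} = 0" unfolding N_def using False
      by (subst emeasure_density) (auto simp: nn_integral_0_iff_AE indicator_def intro!: AE_I2)
    then show ?thesis using F0 False by simp
  next
    case True
    have hb: "has_bochner_integral lborel (\<lambda>r. (A * d) * (indicator {0..R} r * r powr (d - 1))) ((A * d) * (R powr d / d))"
      using has_bochner_integral_powr_0[of "d - 1" R] d True by (intro has_bochner_integral_mult_right) auto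
    have "emeasure N {..<R} = (\<integral>\<^sup>+r. ennreal ((A * d) * (indicator {0<..} r * r powr (d - 1))) * indicator {..<R} r \<partial>lborel)"
      unfolding N_def by (subst emeasure_density) auto
    also have "\<dots> = (\<integral>\<^sup>+r. ennreal ((A * d) * (indicator {0..R} r * r powr (d - 1))) \<partial>lborel)"
      by (intro nn_integral_cong_AE, use AE_lborel_singleton[of 0] AE_lborel_singleton[of R] in eventually_elim)
        (auto simp: indicator_def)
    also have "\<dots> = ennreal (A * d * (R powr d / d))"
      using hb A d by (subst nn_integral_eq_integral) (auto simp: has_bochner_integral_iff)
    finally show ?thesis using F[OF True] d by simp
  qed
  have "M = N"
  \<comment> \<open>Half-lines are closed under intersection and generate the Borel sets; those with
    natural end points exhaust the line and have finite mass.\<close>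
  proof (rule measure_eqI_generator_eq[where E="range lessThan" and \<Omega>=UNIV and A="\<lambda>n. {..<real n}"])
    show "Int_stable (range lessThan :: real set set)"
      unfolding Int_stable_def
    proof (clarify, rule range_eqI)
      show "{..<a} \<inter> {..<b} = {..<min a b}" for a b :: real by auto
    qed
    show "sets M = sigma_sets UNIV (range lessThan)" "sets N = sigma_sets UNIV (range lessThan)"
      by (simp_all add: M_def N_def borel_Iio)
    show "(\<Union>i. {..<real i}) = UNIV"
      using reals_Archimedean2 by auto
    show "emeasure M {..<real i} \<noteq> \<infinity>" for i
      using F0 F[of i] unfolding M by (cases "i = 0") auto
  qed (auto simp: M N)
  then show ?thesis
    using that[of "A * d"] A d unfolding M_def N_def d_def by simp
qed

text \<open>Positive and negative parts of \<open>k\<close> are again angular, so the signed case is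
  a difference of two nonnegative ones. In effect \<open>c\<close> is the surface integral of
  \<open>k\<close> over the unit sphere; it is chosen before \<open>g\<close>, so that one constant
  serves all radial profiles.\<close>

lemma angular_polar:
  fixes k :: "'a::euclidean_space \<Rightarrow> real"
  assumes k: "bounded_angular k B"
  shows "\<exists>c. \<forall>g. g \<in> borel_measurable borel \<longrightarrow>
      integrable lborel (\<lambda>r. indicator {0<..} r * r powr (real DIM('a) - 1) * g r) \<longrightarrow>
      has_bochner_integral lebesgue (\<lambda>y. k y * g (norm y))
        (c * (LINT r|lborel. indicator {0<..} r * r powr (real DIM('a) - 1) * g r))"
proof -
  have nonneg: "\<exists>c. \<forall>g. g \<in> borel_measurable borel \<longrightarrow>
      integrable lborel (\<lambda>r. indicator {0<..} r * r powr (real DIM('a) - 1) * g r) \<longrightarrow>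
      has_bochner_integral lebesgue (\<lambda>y. k y * g (norm y))
        (c * (LINT r|lborel. indicator {0<..} r * r powr (real DIM('a) - 1) * g r))"
    if k: "bounded_angular k B" and nn: "\<And>y. 0 \<le> k y" for k :: "'a \<Rightarrow> real"
  proof -
    have [measurable]: "k \<in> borel_measurable lebesgue" using k by (auto simp: bounded_angular_def)
    have [measurable]: "norm \<in> lebesgue \<rightarrow>\<^sub>M (borel :: real measure)"
      by (rule measurable_completion) simp
    obtain c where c: "0 \<le> c" and eq: "distr (density lebesgue (\<lambda>y. ennreal (k y))) borel norm =
      density lborel (\<lambda>r. ennreal (c * (indicator {0<..} r * r powr (real DIM('a) - 1))))"
      using angular_distr_norm[OF k nn] .
    show ?thesis
    proof (intro exI[of _ c] allI impI)
      fix g :: "real \<Rightarrow> real"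
      assume [measurable]: "g \<in> borel_measurable borel"
        and int: "integrable lborel (\<lambda>r. indicator {0<..} r * r powr (real DIM('a) - 1) * g r)"
      have int': "integrable lborel (\<lambda>r. c * (indicator {0<..} r * r powr (real DIM('a) - 1)) * g r)"
        using integrable_mult_right[OF int, of c] by (simp add: mult.assoc)
      have "integrable (distr (density lebesgue (\<lambda>y. ennreal (k y))) borel norm) g"
        unfolding eq using int' c by (subst integrable_density) auto
      then have "integrable lebesgue (\<lambda>y. k y * g (norm y))"
        using nn by (simp add: integrable_distr_eq integrable_density)
      moreover have "(LINT y|lebesgue. k y * g (norm y)) =
          (LINT r|distr (density lebesgue (\<lambda>y. ennreal (k y))) borel norm. g r)"
        using nn by (simp add: integral_distr integral_density)
      moreover have "\<dots> = c * (LINT r|lborel. indicator {0<..} r * r powr (real DIM('a) - 1) * g r)"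
        unfolding eq using c
        by (subst integral_density) (auto simp: mult.assoc integral_mult_right_zero[symmetric] simp del: integral_mult_right_zero)
      ultimately show "has_bochner_integral lebesgue (\<lambda>y. k y * g (norm y))
          (c * (LINT r|lborel. indicator {0<..} r * r powr (real DIM('a) - 1) * g r))"
        by (simp add: has_bochner_integral_iff)
    qed
  qed
  have pos: "bounded_angular (\<lambda>y. max 0 (k y)) B" and neg: "bounded_angular (\<lambda>y. max 0 (- k y)) B"
    using k unfolding bounded_angular_def by (auto elim!: eventually_mono)
  obtain c\<^sub>1 where c\<^sub>1: "\<And>g. g \<in> borel_measurable borel \<Longrightarrow>
      integrable lborel (\<lambda>r. indicator {0<..} r * r powr (real DIM('a) - 1) * g r) \<Longrightarrow>
      has_bochner_integral lebesgue (\<lambda>y. max 0 (k y) * g (norm y))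
        (c\<^sub>1 * (LINT r|lborel. indicator {0<..} r * r powr (real DIM('a) - 1) * g r))"
    using nonneg[OF pos] by auto
  obtain c\<^sub>2 where c\<^sub>2: "\<And>g. g \<in> borel_measurable borel \<Longrightarrow>
      integrable lborel (\<lambda>r. indicator {0<..} r * r powr (real DIM('a) - 1) * g r) \<Longrightarrow>
      has_bochner_integral lebesgue (\<lambda>y. max 0 (- k y) * g (norm y))
        (c\<^sub>2 * (LINT r|lborel. indicator {0<..} r * r powr (real DIM('a) - 1) * g r))"
    using nonneg[OF neg] by auto
  have eq: "max 0 (k y) * g - max 0 (- k y) * g = k y * g" for y g
    by (simp add: max_def)
  show ?thesis
  proof (intro exI[of _ "c\<^sub>1 - c\<^sub>2"] allI impI)
    fix g :: "real \<Rightarrow> real"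
    assume g: "g \<in> borel_measurable borel"
      "integrable lborel (\<lambda>r. indicator {0<..} r * r powr (real DIM('a) - 1) * g r)"
    show "has_bochner_integral lebesgue (\<lambda>y. k y * g (norm y))
        ((c\<^sub>1 - c\<^sub>2) * (LINT r|lborel. indicator {0<..} r * r powr (real DIM('a) - 1) * g r))"
      using has_bochner_integral_diff[OF c\<^sub>1[OF g] c\<^sub>2[OF g]] by (simp only: eq left_diff_distrib)
  qed
qed

section \<open>The kernel as a function on the whole space\<close>

text \<open>The cones that define the surface measure reach only to radius 1, so the exceptional set
  is first known to be null inside the punctured unit ball. Scaling, which does not change
  directions, spreads this over the whole space.\<close>

lemma AE_sphere_measure_imp_AE_lebesgue:
  assumes "AE \<theta> in (sphere_measure :: 'a::euclidean_space measure). P \<theta>"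
  shows "AE y::'a in lebesgue. P (y /\<^sub>R norm y)"
proof -
  let ?D = "distr (restrict_space lborel (ball (0::'a) 1 - {0})) (restrict_space borel (sphere 0 1)) (\<lambda>y. y /\<^sub>R norm y)"
  have m: "(\<lambda>y::'a. y /\<^sub>R norm y) \<in> restrict_space lborel (ball 0 1 - {0}) \<rightarrow>\<^sub>M restrict_space borel (sphere 0 1)"
    by (intro measurable_restrict_space2 measurable_restrict_space1) (auto simp: space_restrict_space)
  have "AE \<theta> in ?D. P \<theta>"
  proof -
    from assms obtain N where N: "{\<theta> \<in> space sphere_measure. \<not> P \<theta>} \<subseteq> N"
      "emeasure sphere_measure N = 0" "N \<in> sets (sphere_measure :: 'a measure)"
      by (auto elim: AE_E)
    have "emeasure ?D N = 0" using N(2) unfolding sphere_measure_def by simp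
    then show ?thesis
      using N(1,3) by (intro AE_I[of _ _ N]) (auto simp: sphere_measure_def space_scale_measure)
  qed
  from AE_distrD[OF m this]
  have "AE y in restrict_space lborel (ball (0::'a) 1 - {0}). P (y /\<^sub>R norm y)" .
  then have "AE y::'a in lborel. y \<in> ball 0 1 - {0} \<longrightarrow> P (y /\<^sub>R norm y)"
    by (subst (asm) AE_restrict_space_iff) auto
  then have *: "AE y::'a in lebesgue. y \<in> ball 0 1 - {0} \<longrightarrow> P (y /\<^sub>R norm y)"
    by (rule AE_completion)
  \<comment> \<open>Countably many contractions suffice to bring every point into the unit ball, so
    their exceptional sets have a null union.\<close>
  have "AE y::'a in lebesgue. \<forall>n::nat. (1 / real (Suc n)) *\<^sub>R y \<in> ball 0 1 - {0} \<longrightarrow>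
      P ((1 / real (Suc n)) *\<^sub>R y /\<^sub>R norm ((1 / real (Suc n)) *\<^sub>R y))"
    unfolding AE_all_countable by (intro allI AE_lebesgue_scaleR[OF _ *]) auto
  moreover have "AE y::'a in lebesgue. y \<noteq> 0"
    by (intro AE_completion AE_lborel_singleton)
  ultimately show ?thesis
  proof eventually_elim
    case (elim y)
    obtain n where "norm y < real n" using reals_Archimedean2 by blast
    then have "norm ((1 / real (Suc n)) *\<^sub>R y) < 1" by (simp add: field_simps)
    moreover have "(1 / real (Suc n)) *\<^sub>R y /\<^sub>R norm ((1 / real (Suc n)) *\<^sub>R y) = y /\<^sub>R norm y"
      by (simp add: field_simps del: of_nat_Suc)
    ultimately show ?case using elim(1)[rule_format, of n] elim(2) by simp
  qed
qed

text \<open>Measurability for a completed measure is not preserved by composition with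
  \<open>y /\<^sub>R norm y\<close> as such. A Borel version of \<open>\<eta>\<close> is composed
  instead; it agrees with \<open>\<eta>\<close> along almost every point of the space, and
  completeness of Lebesgue measure transfers measurability back.\<close>

lemma kernel_class_bounded_angular:
  fixes \<eta> :: "'a::euclidean_space \<Rightarrow> real"
  assumes \<eta>: "\<eta> \<in> kernel_class lam Lam" and "0 \<le> lam"
  shows "bounded_angular (\<lambda>y. \<eta> (y /\<^sub>R norm y)) Lam"
    and "\<eta> ((- y) /\<^sub>R norm (- y)) = \<eta> (y /\<^sub>R norm y)"
proof -
  have m: "\<eta> \<in> borel_measurable (completion sphere_measure)"
    and sym: "\<And>\<theta>. \<theta> \<in> sphere 0 1 \<Longrightarrow> \<eta> (- \<theta>) = \<eta> \<theta>"
    and b: "AE \<theta> in sphere_measure. lam \<le> \<eta> \<theta> \<and> \<eta> \<theta> \<le> Lam"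
    using \<eta> unfolding kernel_class_def by fastforce+
  show "\<eta> ((- y) /\<^sub>R norm (- y)) = \<eta> (y /\<^sub>R norm y)"
    \<comment> \<open>At \<open>y = 0\<close>, whose normalisation is 0 and not on the sphere, both
      sides are \<open>\<eta> 0\<close>.\<close>
    using sym[of "y /\<^sub>R norm y"] by (cases "y = 0") auto
  obtain \<eta>' where \<eta>': "\<eta>' \<in> borel_measurable (sphere_measure :: 'a measure)"
    and AE: "AE \<theta> in sphere_measure. \<eta> \<theta> = \<eta>' \<theta>"
    using completion_ex_borel_measurable_real[OF m] by auto
  have "\<eta>' \<in> borel_measurable (restrict_space borel (sphere (0::'a) 1))"
    using \<eta>' by (simp add: sphere_measure_def cong: measurable_cong_sets)
  moreover have "(\<lambda>y::'a. y /\<^sub>R norm y) \<in> restrict_space borel (-{0}) \<rightarrow>\<^sub>M restrict_space borel (sphere 0 1)"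
    by (intro measurable_restrict_space2 measurable_restrict_space1) (auto simp: space_restrict_space)
  ultimately have "(\<lambda>y. \<eta>' (y /\<^sub>R norm y)) \<in> borel_measurable (restrict_space borel (-{0}))"
    by (rule measurable_compose[rotated])
  then have "(\<lambda>y. indicator (-{0}) y *\<^sub>R \<eta>' (y /\<^sub>R norm y)) \<in> borel_measurable borel"
    by (subst (asm) borel_measurable_restrict_space_iff) auto
  then have "(\<lambda>y. indicator (-{0}) y *\<^sub>R \<eta>' (y /\<^sub>R norm y)) \<in> borel_measurable lebesgue"
    by (intro measurable_completion) simp
  moreover have "AE y::'a in lebesgue. y \<noteq> 0"
    by (intro AE_completion AE_lborel_singleton)
  then have "AE y in lebesgue. indicator (-{0}) y *\<^sub>R \<eta>' (y /\<^sub>R norm y) = \<eta> (y /\<^sub>R norm y)"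
    using AE_sphere_measure_imp_AE_lebesgue[OF AE] by eventually_elim auto
  ultimately have "(\<lambda>y. \<eta> (y /\<^sub>R norm y)) \<in> borel_measurable lebesgue"
    by (rule borel_measurable_AE)
  moreover have "AE y in lebesgue. \<bar>\<eta> (y /\<^sub>R norm y)\<bar> \<le> Lam"
    using AE_sphere_measure_imp_AE_lebesgue[OF b] by eventually_elim (use \<open>0 \<le> lam\<close> in auto)
  moreover have "\<eta> ((t *\<^sub>R y) /\<^sub>R norm (t *\<^sub>R y)) = \<eta> (y /\<^sub>R norm y)" if "0 < t" for t y
    using that by (simp add: field_simps)
  ultimately show "bounded_angular (\<lambda>y. \<eta> (y /\<^sub>R norm y)) Lam"
    unfolding bounded_angular_def by blast
qed

section \<open>Radial integrals\<close>

text \<open>Polar coordinates with \<open>k = 1\<close>. The constant is quantified before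
  \<open>q\<close> and \<open>R\<close> because it becomes part of the final constant.\<close>

lemma powr_norm_near_0:
  "\<exists>c. \<forall>q R. - real DIM('a) < q \<longrightarrow> 0 \<le> R \<longrightarrow>
    has_bochner_integral lebesgue (\<lambda>y::'a::euclidean_space. indicator (ball 0 R) y * norm y powr q)
      (c * (R powr (real DIM('a) + q) / (real DIM('a) + q)))"
proof -
  define k :: "'a \<Rightarrow> real" where "k = (\<lambda>_. 1)"
  have k: "bounded_angular k 1" by (simp add: bounded_angular_def k_def)
  obtain c where c: "\<And>g. g \<in> borel_measurable borel \<Longrightarrow>
      integrable lborel (\<lambda>r. indicator {0<..} r * r powr (real DIM('a) - 1) * g r) \<Longrightarrow>
      has_bochner_integral lebesgue (\<lambda>y. k y * g (norm y))
        (c * (LINT r|lborel. indicator {0<..} r * r powr (real DIM('a) - 1) * g r))"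
    using angular_polar[OF k] by blast
  have "has_bochner_integral lebesgue (\<lambda>y::'a. indicator (ball 0 R) y * norm y powr q)
      (c * (R powr (real DIM('a) + q) / (real DIM('a) + q)))"
    if q: "- real DIM('a) < q" and "0 \<le> R" for q R
  proof -
    define g where "g r = indicator {..<R} r * r powr q" for r
    have [measurable]: "g \<in> borel_measurable borel" by (simp add: g_def[abs_def])
    have hb: "has_bochner_integral lborel (\<lambda>r. indicator {0..R} r * r powr (real DIM('a) - 1 + q))
        (R powr (real DIM('a) + q) / (real DIM('a) + q))"
      using has_bochner_integral_powr_0[of "real DIM('a) - 1 + q" R] that by simp
    have "has_bochner_integral lborel (\<lambda>r. indicator {0<..} r * r powr (real DIM('a) - 1) * g r)
        (R powr (real DIM('a) + q) / (real DIM('a) + q))"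
    proof (rule has_bochner_integral_cong_AE[THEN iffD1, OF _ _ _ hb])
      show "AE r in lborel. indicator {0..R} r * r powr (real DIM('a) - 1 + q) =
          indicator {0<..} r * r powr (real DIM('a) - 1) * g r"
        using AE_lborel_singleton[of 0] AE_lborel_singleton[of R]
        by eventually_elim (auto simp: indicator_def g_def powr_add)
    qed auto
    then have "has_bochner_integral lebesgue (\<lambda>y. k y * g (norm y))
        (c * (R powr (real DIM('a) + q) / (real DIM('a) + q)))"
      using c[of g] by (simp add: has_bochner_integral_iff)
    moreover have "k y * g (norm y) = indicator (ball 0 R) y * norm y powr q" for y
      by (simp add: k_def g_def indicator_def)
    ultimately show ?thesis by simp
  qed
  then show ?thesis by blast
qed

lemma integrable_powr_norm_at_infinity:
  assumes "q < - real DIM('a)" "0 < R"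
  shows "integrable lebesgue (\<lambda>y::'a::euclidean_space. indicator (- ball 0 R) y * norm y powr q)"
proof -
  define k :: "'a \<Rightarrow> real" where "k = (\<lambda>_. 1)"
  have k: "bounded_angular k 1" by (simp add: bounded_angular_def k_def)
  obtain c where c: "\<And>g. g \<in> borel_measurable borel \<Longrightarrow>
      integrable lborel (\<lambda>r. indicator {0<..} r * r powr (real DIM('a) - 1) * g r) \<Longrightarrow>
      has_bochner_integral lebesgue (\<lambda>y. k y * g (norm y))
        (c * (LINT r|lborel. indicator {0<..} r * r powr (real DIM('a) - 1) * g r))"
    using angular_polar[OF k] by blast
  define g where "g r = indicator {R..} r * r powr q" for r
  have [measurable]: "g \<in> borel_measurable borel" by (simp add: g_def[abs_def])
  have "indicator {R..} r * r powr (real DIM('a) - 1 + q) =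
      indicator {0<..} r * r powr (real DIM('a) - 1) * g r" for r
    using \<open>0 < R\<close> by (auto simp: indicator_def g_def powr_add)
  then have "integrable lborel (\<lambda>r. indicator {0<..} r * r powr (real DIM('a) - 1) * g r)"
    using has_bochner_integral_powr_inf[of "real DIM('a) - 1 + q" R] assms
    by (simp add: has_bochner_integral_iff)
  then have "integrable lebesgue (\<lambda>y. k y * g (norm y))"
    using c[of g] by (simp add: has_bochner_integral_iff)
  moreover have "k y * g (norm y) = indicator (- ball 0 R) y * norm y powr q" for y
    by (simp add: k_def g_def indicator_def)
  ultimately show ?thesis by simp
qed

lemma powr_mult_power:
  fixes x :: real
  assumes "0 < x"
  shows "x powr a * x ^ n = x powr (a + real n)"
  using assms by (simp add: powr_add powr_realpow)

lemma borel_measurable_reg_kernel [measurable]: "reg_kernel d s \<epsilon> \<in> borel_measurable borel"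
proof -
  have "(\<lambda>r. if \<epsilon> \<le> r then r powr (- d - 2 * s)
      else \<epsilon> powr (- d - 2 * s) + reg_gamma d s \<epsilon> * (r ^ 2 - \<epsilon> ^ 2)
             + reg_nu d s \<epsilon> * (r ^ 3 - \<epsilon> ^ 3)) \<in> borel_measurable borel"
    by measurable
  then show ?thesis by (simp add: reg_kernel_def[abs_def])
qed

text \<open>This is the moment condition for which the two coefficients were designed. On the
  interval from 0 to \<epsilon> the integrand is a combination of four powers of \<open>r\<close>;
  the singular one is \<open>r powr (1 - 2 * s)\<close>, integrable since
  \<open>s < 1\<close>.\<close>

lemma reg_kernel_moment:
  fixes d s \<epsilon> :: real
  assumes "1 \<le> d" "0 < s" "s < 1" "0 < \<epsilon>"
  shows "has_bochner_integral lborel (\<lambda>r. indicator {0<..} r * r powr (d - 1) *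
    (indicator {..<\<epsilon>} r * (r\<^sup>2 * (r powr (- d - 2 * s) - reg_kernel d s \<epsilon> r)))) 0"
proof -
  define P where "P = \<epsilon> powr (- d - 2 * s)"
  \<comment> \<open>\<open>g\<close> and \<open>n\<close> are \<open>reg_gamma\<close> and
    \<open>reg_nu\<close> stripped of their powers of \<epsilon>; \<open>A\<close> below is minus
    nothing else than the constant term of the cubic polynomial in \<open>r\<close>, taken with its
    own sign.\<close>
  define g where "g = - ((4 + d) * (d + 2 * s) * (3 + d + 2 * s) / (4 * (1 - s)))"
  define n where "n = (5 + d) * (d + 2 * s) * (2 + d + 2 * s) / (6 * (1 - s))"
  define A where "A = P - reg_gamma d s \<epsilon> * \<epsilon>\<^sup>2 - reg_nu d s \<epsilon> * \<epsilon> ^ 3"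
  let ?I = "\<lambda>a r::real. indicator {0..\<epsilon>} r * r powr a"
  have hb: "has_bochner_integral lborel (?I a) (\<epsilon> powr (a + 1) / (a + 1))" if "-1 < a" for a
    using has_bochner_integral_powr_0[of a \<epsilon>] that assms by simp
  have hb: "has_bochner_integral lborel
      (\<lambda>r. ?I (1 - 2 * s) r - A * ?I (d + 1) r - reg_gamma d s \<epsilon> * ?I (d + 3) r - reg_nu d s \<epsilon> * ?I (d + 4) r)
      (\<epsilon> powr (1 - 2 * s + 1) / (1 - 2 * s + 1) - A * (\<epsilon> powr (d + 1 + 1) / (d + 1 + 1))
       - reg_gamma d s \<epsilon> * (\<epsilon> powr (d + 3 + 1) / (d + 3 + 1)) - reg_nu d s \<epsilon> * (\<epsilon> powr (d + 4 + 1) / (d + 4 + 1)))"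
    using assms by (intro has_bochner_integral_diff has_bochner_integral_mult_right hb) auto
  note pm = powr_mult_power[OF \<open>0 < \<epsilon>\<close>]
  have pw: "\<epsilon> powr (2 - 2 * s) = P * \<epsilon> powr (d + 2)" "\<epsilon> powr (d + 4) = \<epsilon>\<^sup>2 * \<epsilon> powr (d + 2)"
    "\<epsilon> powr (d + 5) = \<epsilon> ^ 3 * \<epsilon> powr (d + 2)"
    "reg_gamma d s \<epsilon> * \<epsilon>\<^sup>2 = g * P" "reg_nu d s \<epsilon> * \<epsilon> ^ 3 = n * P"
    using pm[of "d + 2" 2] pm[of "d + 2" 3] pm[of "- d - 2 * s - 2" 2] pm[of "- d - 2 * s - 3" 3]
    unfolding P_def reg_gamma_def reg_nu_def g_def n_def
    by (simp_all add: powr_add[symmetric] mult.assoc) (simp_all add: mult.commute add.commute)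
  have "\<epsilon> powr (1 - 2 * s + 1) / (1 - 2 * s + 1) - A * (\<epsilon> powr (d + 1 + 1) / (d + 1 + 1))
       - reg_gamma d s \<epsilon> * (\<epsilon> powr (d + 3 + 1) / (d + 3 + 1)) - reg_nu d s \<epsilon> * (\<epsilon> powr (d + 4 + 1) / (d + 4 + 1))
     = P * \<epsilon> powr (d + 2) / (2 - 2 * s) - A * \<epsilon> powr (d + 2) / (d + 2)
       - (reg_gamma d s \<epsilon> * \<epsilon>\<^sup>2) * \<epsilon> powr (d + 2) / (d + 4) - (reg_nu d s \<epsilon> * \<epsilon> ^ 3) * \<epsilon> powr (d + 2) / (d + 5)"
    by (simp add: add.assoc pw(1-3) mult.assoc)
  \<comment> \<open>All four terms scale alike in \<epsilon>, so only an identity between rational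
    functions of \<open>d\<close> and \<open>s\<close> is left.\<close>
  also have "\<dots> = P * \<epsilon> powr (d + 2) * (1 / (2 - 2 * s) - (1 - g - n) / (d + 2) - g / (d + 4) - n / (d + 5))"
    unfolding A_def pw(4,5) by (simp add: algebra_simps diff_divide_distrib)
  also have "1 / (2 - 2 * s) - (1 - g - n) / (d + 2) - g / (d + 4) - n / (d + 5) = 0"
  proof -
    \<comment> \<open>Since \<open>1 / (d + 2) - 1 / (d + 4) = 2 / ((d + 2) * (d + 4))\<close>, and
      similarly with \<open>d + 5\<close>, the factors \<open>4 + d\<close> and \<open>5 + d\<close>
      of the coefficients cancel. The two contributions add up to
      \<open>- (d + 2 * s) / (2 * (1 - s) * (d + 2))\<close>, the negative of
      \<open>1 / (2 - 2 * s) - 1 / (d + 2)\<close>.\<close>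
    have "g / (d + 2) - g / (d + 4) = - ((d + 2 * s) * (3 + d + 2 * s)) / (2 * (1 - s) * (d + 2))"
      using assms by (simp add: g_def divide_simps) (simp add: algebra_simps power2_eq_square)
    moreover have "n / (d + 2) - n / (d + 5) = ((d + 2 * s) * (2 + d + 2 * s)) / (2 * (1 - s) * (d + 2))"
      using assms by (simp add: n_def divide_simps) (simp add: algebra_simps power2_eq_square)
    moreover have "1 / (2 - 2 * s) - 1 / (d + 2) + - ((d + 2 * s) * (3 + d + 2 * s)) / (2 * (1 - s) * (d + 2))
        + ((d + 2 * s) * (2 + d + 2 * s)) / (2 * (1 - s) * (d + 2)) = 0"
      using assms by (simp add: divide_simps) (simp add: algebra_simps power2_eq_square)
    ultimately show ?thesis by (simp add: diff_divide_distrib)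
  qed
  finally have hb0: "has_bochner_integral lborel
      (\<lambda>r. ?I (1 - 2 * s) r - A * ?I (d + 1) r - reg_gamma d s \<epsilon> * ?I (d + 3) r - reg_nu d s \<epsilon> * ?I (d + 4) r) 0"
    using hb by simp
  show ?thesis
  proof (rule has_bochner_integral_cong_AE[THEN iffD1, OF _ _ _ hb0])
    show "AE r in lborel. ?I (1 - 2 * s) r - A * ?I (d + 1) r - reg_gamma d s \<epsilon> * ?I (d + 3) r - reg_nu d s \<epsilon> * ?I (d + 4) r =
      indicator {0<..} r * r powr (d - 1) *
      (indicator {..<\<epsilon>} r * (r\<^sup>2 * (r powr (- d - 2 * s) - reg_kernel d s \<epsilon> r)))"
      using AE_lborel_singleton[of 0] AE_lborel_singleton[of \<epsilon>]
    proof eventually_elim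
      case (elim r)
      show ?case
      proof (cases "0 < r \<and> r < \<epsilon>")
        case True
        then have "0 < r" by simp
        note pm = powr_mult_power[OF this]
        have p: "r powr (1 - 2 * s) = r powr (d - 1) * r\<^sup>2 * r powr (- d - 2 * s)"
          "r powr (d + 1) = r powr (d - 1) * r\<^sup>2" "r powr (d + 3) = r powr (d - 1) * r\<^sup>2 * r\<^sup>2"
          "r powr (d + 4) = r powr (d - 1) * r\<^sup>2 * r ^ 3"
          using pm[of "d - 1" 2] pm[of "d + 1" 2] pm[of "d + 1" 3]
          by (simp_all add: powr_add[symmetric] add.commute)
        show ?thesis using True
          unfolding p by (simp add: indicator_def reg_kernel_def A_def P_def algebra_simps)
      qed (use elim in \<open>auto simp: indicator_def\<close>)
    qed
  qed auto
qed

text \<open>The summands are the sizes of the constant, quadratic and cubic contributions to the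
  regularised kernel, measured in units of \<open>\<epsilon> powr (- d - 2 * s)\<close>. They do not
  depend on \<epsilon>.\<close>

definition reg_bound :: "real \<Rightarrow> real \<Rightarrow> real" where
  "reg_bound d s = 1 + (4 + d) * (d + 2 * s) * (3 + d + 2 * s) / (4 * (1 - s))
     + (5 + d) * (d + 2 * s) * (2 + d + 2 * s) / (6 * (1 - s))"

lemma abs_reg_kernel_le:
  assumes "0 \<le> d" "0 < s" "s < 1" "0 \<le> r" "r < \<epsilon>"
  shows "\<bar>reg_kernel d s \<epsilon> r\<bar> \<le> reg_bound d s * \<epsilon> powr (- d - 2 * s)"
proof -
  define P where "P = \<epsilon> powr (- d - 2 * s)"
  define g where "g = ((4 + d) * (d + 2 * s) * (3 + d + 2 * s) / (4 * (1 - s)))"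
  define n where "n = (5 + d) * (d + 2 * s) * (2 + d + 2 * s) / (6 * (1 - s))"
  have "0 < \<epsilon>" using assms by simp
  have nn: "0 \<le> g" "0 \<le> n" "0 \<le> P" using assms by (auto simp: g_def n_def P_def)
  have e: "\<epsilon> powr (- d - 2 * s - 2) * \<epsilon>\<^sup>2 = P" "\<epsilon> powr (- d - 2 * s - 3) * \<epsilon> ^ 3 = P"
    unfolding P_def using powr_mult_power[OF \<open>0 < \<epsilon>\<close>] by simp_all
  have r: "\<bar>r\<^sup>2 - \<epsilon>\<^sup>2\<bar> \<le> \<epsilon>\<^sup>2" "\<bar>r ^ 3 - \<epsilon> ^ 3\<bar> \<le> \<epsilon> ^ 3"
    using power_mono[of r \<epsilon> 2] power_mono[of r \<epsilon> 3] assms by auto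
  have coeff: "reg_gamma d s \<epsilon> = - (g * \<epsilon> powr (- d - 2 * s - 2))" "reg_nu d s \<epsilon> = n * \<epsilon> powr (- d - 2 * s - 3)"
    by (simp_all add: reg_gamma_def reg_nu_def g_def n_def)
  have "\<bar>reg_gamma d s \<epsilon> * (r\<^sup>2 - \<epsilon>\<^sup>2)\<bar> \<le> g * \<epsilon> powr (- d - 2 * s - 2) * \<epsilon>\<^sup>2"
    unfolding abs_mult using r nn by (intro mult_mono) (auto simp: coeff abs_mult)
  moreover have "\<bar>reg_nu d s \<epsilon> * (r ^ 3 - \<epsilon> ^ 3)\<bar> \<le> n * \<epsilon> powr (- d - 2 * s - 3) * \<epsilon> ^ 3"
    unfolding abs_mult using r nn by (intro mult_mono) (auto simp: coeff abs_mult)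
  ultimately have "\<bar>P + reg_gamma d s \<epsilon> * (r\<^sup>2 - \<epsilon>\<^sup>2) + reg_nu d s \<epsilon> * (r ^ 3 - \<epsilon> ^ 3)\<bar> \<le> P + g * P + n * P"
    using nn e by (simp add: mult.assoc)
  then show ?thesis
    using assms by (simp add: reg_kernel_def reg_bound_def P_def g_def n_def algebra_simps)
qed

text \<open>Polar coordinates turn the integral into a multiple of the vanishing radial moment,
  whatever the angular part is.\<close>

lemma angular_reg_kernel_moment:
  fixes k :: "'a::euclidean_space \<Rightarrow> real" and s \<epsilon> :: real
  defines "d \<equiv> real DIM('a)"
  assumes k: "bounded_angular k B" and "0 < s" "s < 1" "0 < \<epsilon>"
  shows "has_bochner_integral lebesgue (\<lambda>y. k y * (indicator (ball 0 \<epsilon>) y *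
    ((norm y)\<^sup>2 * (norm y powr (- d - 2 * s) - reg_kernel d s \<epsilon> (norm y))))) 0"
proof -
  obtain c where c: "\<And>g. g \<in> borel_measurable borel \<Longrightarrow>
      integrable lborel (\<lambda>r. indicator {0<..} r * r powr (real DIM('a) - 1) * g r) \<Longrightarrow>
      has_bochner_integral lebesgue (\<lambda>y. k y * g (norm y))
        (c * (LINT r|lborel. indicator {0<..} r * r powr (real DIM('a) - 1) * g r))"
    using angular_polar[OF k] by blast
  define g where "g r = indicator {..<\<epsilon>} r * (r\<^sup>2 * (r powr (- d - 2 * s) - reg_kernel d s \<epsilon> r))" for r
  have [measurable]: "g \<in> borel_measurable borel" by (simp add: g_def[abs_def])
  have "has_bochner_integral lborel (\<lambda>r. indicator {0<..} r * r powr (real DIM('a) - 1) * g r) 0"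
    unfolding g_def d_def using assms by (intro reg_kernel_moment) (auto simp: Suc_le_eq)
  then have "has_bochner_integral lebesgue (\<lambda>y. k y * g (norm y)) 0"
    using c[of g] by (simp add: has_bochner_integral_iff)
  then show ?thesis by (simp add: g_def indicator_def)
qed

section \<open>Second differences of Hoelder functions\<close>

text \<open>For smooth \<open>f\<close> this is the \<open>j\<close>-th derivative of
  \<open>\<lambda>t. f (z + t *\<^sub>R y)\<close> at 0. The sum runs over ordered lists of basis
  vectors, so no multinomial coefficients appear.\<close>

definition dir_deriv :: "nat \<Rightarrow> ('a::euclidean_space \<Rightarrow> real) \<Rightarrow> 'a \<Rightarrow> 'a \<Rightarrow> real" where
  "dir_deriv j f y z = (\<Sum>bs\<in>multi_indices j. (\<Prod>b\<leftarrow>bs. y \<bullet> b) * partials bs f z)"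

lemma finite_multi_indices [simp]: "finite (multi_indices j)"
  unfolding multi_indices_def by (rule finite_lists_length_eq) simp

lemma card_multi_indices: "card (multi_indices j :: 'a::euclidean_space list set) = DIM('a) ^ j"
  unfolding multi_indices_def by (rule card_lists_length_eq) simp

lemma multi_indices_0: "multi_indices 0 = {[]}"
  by (auto simp: multi_indices_def)

lemma dir_deriv_0 [simp]: "dir_deriv 0 f y z = f z"
  by (simp add: dir_deriv_def multi_indices_0)

text \<open>The head of a list is the outermost derivative; splitting it off gives the form that the
  chain rule along a line produces.\<close>

lemma dir_deriv_Suc:
  "dir_deriv (Suc j) f y z =
   (\<Sum>b\<in>Basis. \<Sum>bs\<in>multi_indices j. (y \<bullet> b) * (\<Prod>b\<leftarrow>bs. y \<bullet> b) * partials (b # bs) f z)"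
proof -
  have "multi_indices (Suc j) = (\<lambda>(b, bs). b # bs) ` (Basis \<times> multi_indices j :: ('a \<times> 'a list) set)"
    by (auto simp: multi_indices_def length_Suc_conv image_iff)
  moreover have "inj_on (\<lambda>(b, bs). b # bs) (Basis \<times> multi_indices j :: ('a \<times> 'a list) set)"
    by (auto simp: inj_on_def)
  ultimately show ?thesis
    unfolding dir_deriv_def
    by (simp add: sum.reindex sum.cartesian_product case_prod_unfold)
qed

lemma abs_prod_list_inner_le:
  fixes y :: "'a::euclidean_space"
  assumes "set bs \<subseteq> Basis"
  shows "\<bar>\<Prod>b\<leftarrow>bs. y \<bullet> b\<bar> \<le> norm y ^ length bs"
  using assms
proof (induction bs)
  case (Cons b bs)
  then show ?case
    using Basis_le_norm[of b y] by (auto simp: abs_mult intro!: mult_mono)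
qed simp

lemma abs_dir_deriv_diff_le:
  fixes y :: "'a::euclidean_space"
  assumes "\<And>bs. bs \<in> multi_indices j \<Longrightarrow> \<bar>partials bs f z - partials bs f z'\<bar> \<le> E"
  shows "\<bar>dir_deriv j f y z - dir_deriv j f y z'\<bar> \<le> real DIM('a) ^ j * norm y ^ j * E"
proof -
  have "\<bar>dir_deriv j f y z - dir_deriv j f y z'\<bar> =
      \<bar>\<Sum>bs\<in>multi_indices j. (\<Prod>b\<leftarrow>bs. y \<bullet> b) * (partials bs f z - partials bs f z')\<bar>"
    by (simp add: dir_deriv_def sum_subtractf right_diff_distrib)
  also have "\<dots> \<le> (\<Sum>bs\<in>(multi_indices j :: 'a list set). norm y ^ j * E)"
  proof (rule sum_abs[THEN order_trans], rule sum_mono)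
    fix bs :: "'a list" assume bs: "bs \<in> multi_indices j"
    have "\<bar>\<Prod>b\<leftarrow>bs. y \<bullet> b\<bar> \<le> norm y ^ j"
      using abs_prod_list_inner_le[of bs y] bs by (auto simp: multi_indices_def)
    then show "\<bar>(\<Prod>b\<leftarrow>bs. y \<bullet> b) * (partials bs f z - partials bs f z')\<bar> \<le> norm y ^ j * E"
      unfolding abs_mult using assms[OF bs] by (intro mult_mono) auto
  qed
  finally show ?thesis by (simp add: card_multi_indices)
qed

text \<open>Chain rule along a line, with the direction expanded in the basis. The factor
  \<open>c\<close> will be 1 or -1, which covers both halves of the second difference.\<close>

lemma dir_deriv_has_derivative:
  fixes x y :: "'a::euclidean_space"
  assumes Ck: "Ck_on k U f" and U: "open U" and "j < k" and z: "x + (c * t) *\<^sub>R y \<in> U"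
  shows "((\<lambda>t. dir_deriv j f y (x + (c * t) *\<^sub>R y)) has_real_derivative
          c * dir_deriv (Suc j) f y (x + (c * t) *\<^sub>R y)) (at t)"
proof -
  let ?z = "x + (c * t) *\<^sub>R y"
  have D: "((\<lambda>t. partials bs f (x + (c * t) *\<^sub>R y)) has_real_derivative
      c * (\<Sum>b\<in>Basis. (y \<bullet> b) * partials (b # bs) f ?z)) (at t)"
    if bs: "bs \<in> multi_indices j" for bs
  proof -
    let ?F = "frechet_derivative (partials bs f) (at ?z)"
    have "partials bs f differentiable_on U"
      using Ck bs \<open>j < k\<close> by (auto simp: Ck_on_def)
    then have "partials bs f differentiable (at ?z)"
      using U z by (auto simp: differentiable_on_eq_differentiable_at)
    then have F: "(partials bs f has_derivative ?F) (at ?z)"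
      by (simp add: frechet_derivative_works)
    have "((\<lambda>t. partials bs f (x + (c * t) *\<^sub>R y)) has_derivative (\<lambda>h. ?F ((c * h) *\<^sub>R y))) (at t)"
      by (rule has_derivative_compose[where g="partials bs f" and f="\<lambda>t. x + (c * t) *\<^sub>R y", OF _ F])
        (auto intro!: derivative_eq_intros)
    moreover have "?F ((c * h) *\<^sub>R y) = c * (\<Sum>b\<in>Basis. (y \<bullet> b) * partials (b # bs) f ?z) * h" for h
    proof -
      interpret F: linear ?F using F by (rule has_derivative_linear)
      have "?F y = ?F (\<Sum>b\<in>Basis. (y \<bullet> b) *\<^sub>R b)" by (simp add: euclidean_representation)
      also have "\<dots> = (\<Sum>b\<in>Basis. (y \<bullet> b) * ?F b)" by (simp add: F.sum F.scale)
      finally show ?thesis by (simp add: F.scale)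
    qed
    ultimately show ?thesis by (simp add: has_field_derivative_def)
  qed
  have eq: "c * dir_deriv (Suc j) f y ?z =
      (\<Sum>bs\<in>multi_indices j. (\<Prod>b\<leftarrow>bs. y \<bullet> b) * (c * (\<Sum>b\<in>Basis. (y \<bullet> b) * partials (b # bs) f ?z)))"
    unfolding dir_deriv_Suc
    by (subst sum.swap) (simp add: sum_distrib_left mult_ac)
  show ?thesis
    unfolding eq unfolding dir_deriv_def
    by (intro DERIV_sum DERIV_cmult D)
qed

text \<open>Taylor's formula in one variable for the symmetric difference along the segment. As
  \<open>\<beta> < 4\<close> forces \<open>k \<le> 3\<close>, the only even order between 0 and 4 is
  2. The Hoelder bound on the derivatives of order \<open>k\<close> controls the remainder; the
  factor 2 counts the two points \<open>x + t *\<^sub>R y\<close> and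
  \<open>x - t *\<^sub>R y\<close>, and \<open>DIM('a) ^ k\<close> counts the lists of length
  \<open>k\<close>.\<close>

lemma holder_second_difference:
  fixes f :: "'a::euclidean_space \<Rightarrow> real" and \<beta> H \<epsilon> :: real
  defines "k \<equiv> nat \<lfloor>\<beta>\<rfloor>"
  assumes \<beta>: "0 \<le> \<beta>" "\<beta> < 4"
    and Ck: "Ck_on k (ball x \<epsilon>) f" and "0 \<le> H"
    and holder: "\<And>bs z. bs \<in> multi_indices k \<Longrightarrow> z \<in> ball x \<epsilon> \<Longrightarrow>
       \<bar>partials bs f z - partials bs f x\<bar> \<le> H * dist z x powr frac \<beta>"
    and y: "norm y < \<epsilon>"
  shows "\<bar>f (x + y) + f (x - y) - 2 * f x - (if 2 \<le> k then dir_deriv 2 f y x else 0)\<bar>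
         \<le> 2 * real DIM('a) ^ k * H * norm y powr \<beta>"
proof -
  have k: "k \<le> 3" using \<beta> unfolding k_def by linarith
  have \<beta>_eq: "\<beta> = real k + frac \<beta>" using \<beta> by (simp add: k_def frac_def)
  \<comment> \<open>\<open>\<phi> j\<close> is the \<open>j\<close>-th derivative of \<open>\<lambda>t. f (x + t *\<^sub>R y) + f (x - t *\<^sub>R y) - 2 * f x\<close>.\<close>
  define \<phi> where "\<phi> j t = dir_deriv j f y (x + (1 * t) *\<^sub>R y) + (- 1) ^ j * dir_deriv j f y (x + (- 1 * t) *\<^sub>R y)
    - (if j = 0 then 2 * f x else 0)" for j t
  have in_ball: "x + (c * t) *\<^sub>R y \<in> ball x \<epsilon>" if "\<bar>c\<bar> = 1" "0 \<le> t" "t \<le> 1" for c t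
  proof -
    have "\<bar>c * t\<bar> * norm y \<le> 1 * norm y" using that by (intro mult_right_mono) (auto simp: abs_mult)
    then show ?thesis using y by (simp add: dist_norm)
  qed
  have pw: "norm y ^ k * norm y powr frac \<beta> = norm y powr \<beta>"
  \<comment> \<open>At \<open>y = 0\<close> both sides vanish, also for \<open>k = 0\<close>,
    because \<open>0 powr a = 0\<close>.\<close>
  proof (cases "y = 0")
    case False
    then show ?thesis by (subst (2) \<beta>_eq) (simp add: powr_add powr_realpow)
  qed auto
  have near: "\<bar>dir_deriv k f y (x + (c * t) *\<^sub>R y) - dir_deriv k f y x\<bar> \<le> real DIM('a) ^ k * H * norm y powr \<beta>"
    if "\<bar>c\<bar> = 1" "0 \<le> t" "t \<le> 1" for c t
  proof -
    have "\<bar>dir_deriv k f y (x + (c * t) *\<^sub>R y) - dir_deriv k f y x\<bar> \<le>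
        real DIM('a) ^ k * norm y ^ k * (H * norm y powr frac \<beta>)"
    proof (rule abs_dir_deriv_diff_le)
      fix bs :: "'a list" assume bs: "bs \<in> multi_indices k"
      have "\<bar>c * t\<bar> * norm y \<le> 1 * norm y" using that by (intro mult_right_mono) (auto simp: abs_mult)
      then have "dist (x + (c * t) *\<^sub>R y) x powr frac \<beta> \<le> norm y powr frac \<beta>"
        by (intro powr_mono2) (auto simp: dist_norm frac_ge_0)
      then show "\<bar>partials bs f (x + (c * t) *\<^sub>R y) - partials bs f x\<bar> \<le> H * norm y powr frac \<beta>"
        using holder[OF bs in_ball[OF that]] \<open>0 \<le> H\<close> by (meson mult_left_mono order_trans)
    qed
    also have "\<dots> = real DIM('a) ^ k * H * norm y powr \<beta>" using pw by (simp add: mult_ac)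
    finally show ?thesis .
  qed
  have \<phi>k: "\<bar>\<phi> k t - \<phi> k 0\<bar> \<le> 2 * (real DIM('a) ^ k * H * norm y powr \<beta>)" if "0 \<le> t" "t \<le> 1" for t
  proof -
    have "\<phi> k t - \<phi> k 0 = (dir_deriv k f y (x + (1 * t) *\<^sub>R y) - dir_deriv k f y x) +
        (- 1) ^ k * (dir_deriv k f y (x + (- 1 * t) *\<^sub>R y) - dir_deriv k f y x)"
      by (simp add: \<phi>_def algebra_simps)
    also have "\<bar>\<dots>\<bar> \<le> \<bar>dir_deriv k f y (x + (1 * t) *\<^sub>R y) - dir_deriv k f y x\<bar> +
        \<bar>dir_deriv k f y (x + (- 1 * t) *\<^sub>R y) - dir_deriv k f y x\<bar>"
      by (rule abs_triangle_ineq[THEN order_trans]) (simp add: abs_mult power_abs)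
    finally show ?thesis using near[of 1 t] near[of "-1" t] that by simp
  qed
  have \<phi>0: "\<phi> 0 0 = 0" "\<phi> 1 0 = 0" "\<phi> 2 0 = 2 * dir_deriv 2 f y x" "\<phi> 3 0 = 0"
    by (simp_all add: \<phi>_def)
  have goal: "f (x + y) + f (x - y) - 2 * f x = \<phi> 0 1"
    by (simp add: \<phi>_def)
  \<comment> \<open>The remainder is needed as an increment of \<open>\<phi> k\<close>, since the
    Hoelder condition bounds differences only. For \<open>k = 0\<close> there is nothing to
    differentiate and \<open>t = 1\<close> works.\<close>
  have "\<exists>t. 0 \<le> t \<and> t \<le> 1 \<and>
     \<phi> 0 1 - (if 2 \<le> k then dir_deriv 2 f y x else 0) = (\<phi> k t - \<phi> k 0) / fact k"
  proof (cases "k = 0")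
    case True
    then show ?thesis using \<phi>0 by (intro exI[of _ 1]) simp
  next
    case False
    have "DERIV (\<phi> m) t :> \<phi> (Suc m) t" if "m < k" "0 \<le> t" "t \<le> 1" for m t
    proof -
      note D = dir_deriv_has_derivative[OF Ck open_ball \<open>m < k\<close> in_ball]
      have "((\<lambda>t. dir_deriv m f y (x + (1 * t) *\<^sub>R y) + (- 1) ^ m * dir_deriv m f y (x + (- 1 * t) *\<^sub>R y)
          - (if m = 0 then 2 * f x else 0)) has_real_derivative
          1 * dir_deriv (Suc m) f y (x + (1 * t) *\<^sub>R y) + (- 1) ^ m * (- 1 * dir_deriv (Suc m) f y (x + (- 1 * t) *\<^sub>R y)) - 0) (at t)"
        using that by (intro DERIV_diff DERIV_add DERIV_cmult DERIV_const D) auto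
      then show ?thesis
        unfolding \<phi>_def[abs_def] by simp
    qed
    then obtain t where t: "0 < t" "t < 1"
      "\<phi> 0 1 = (\<Sum>m<k. \<phi> m 0 / fact m * 1 ^ m) + \<phi> k t / fact k * 1 ^ k"
      using Maclaurin[of 1 k \<phi> "\<phi> 0"] False by auto
    \<comment> \<open>For odd \<open>k\<close> the subtracted \<open>\<phi> k 0\<close> is zero. For
      \<open>k = 2\<close> it accounts for the quadratic term, which for \<open>k = 3\<close> is
      already the summand of order 2 in the Taylor sum.\<close>
    have "k = 1 \<or> k = 2 \<or> k = 3" using k False by linarith
    then have "\<phi> 0 1 - (if 2 \<le> k then dir_deriv 2 f y x else 0) = (\<phi> k t - \<phi> k 0) / fact k"
      using t(3) \<phi>0 by (auto simp: eval_nat_numeral lessThan_Suc)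
    then show ?thesis using t by (intro exI[of _ t]) auto
  qed
  then obtain t where t: "0 \<le> t" "t \<le> 1"
     "\<phi> 0 1 - (if 2 \<le> k then dir_deriv 2 f y x else 0) = (\<phi> k t - \<phi> k 0) / fact k" by blast
  have "\<bar>(\<phi> k t - \<phi> k 0) / fact k\<bar> \<le> \<bar>\<phi> k t - \<phi> k 0\<bar>"
    using mult_left_mono[OF fact_ge_1[of k, where 'a=real] abs_ge_zero, of "\<phi> k t - \<phi> k 0"]
    by (simp add: divide_le_eq)
  then show ?thesis using \<phi>k[OF t(1,2)] unfolding goal t(3) by simp
qed

section \<open>Comparison of the two operators\<close>

lemma measurable_shift_lebesgue:
  fixes u :: "'a::euclidean_space \<Rightarrow> real"
  assumes [measurable]: "u \<in> borel_measurable borel"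
  shows "(\<lambda>y. u (x + y)) \<in> borel_measurable lebesgue" "(\<lambda>y. u (x - y)) \<in> borel_measurable lebesgue"
  by (rule measurable_completion; simp)+

text \<open>In the application \<open>h\<close> is the kernel extended along rays, \<open>u\<close>
  the extension of \<open>w\<close> by zero, and \<open>Q\<close> the second-order Taylor term, or 0
  if \<open>\<beta> < 2\<close>. The regularity of \<open>w\<close> is condensed into
  \<open>near\<close>.\<close>

context
  fixes h u Q :: "'a::euclidean_space \<Rightarrow> real" and x :: 'a and s \<beta> \<epsilon> Lam M B C\<^sub>1 :: real
  assumes h: "bounded_angular h Lam" and h_even: "\<And>y. h (- y) = h y" and Lam: "0 \<le> Lam"
    and u[measurable]: "u \<in> borel_measurable borel" and uM: "\<And>y. \<bar>u y\<bar> \<le> M"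
    and s: "0 < s" "s < 1" and \<beta>: "2 * s < \<beta>" and \<epsilon>: "0 < \<epsilon>" and C\<^sub>1: "0 \<le> C\<^sub>1"
    and Qm: "Q \<in> borel_measurable borel" and Qhom: "\<And>t y. Q (t *\<^sub>R y) = t\<^sup>2 * Q y"
    and QB: "\<And>y. \<bar>Q y\<bar> \<le> B * (norm y)\<^sup>2"
    and near: "\<And>y. norm y < \<epsilon> \<Longrightarrow> \<bar>u (x + y) + u (x - y) - 2 * u x - Q y\<bar> \<le> C\<^sub>1 * norm y powr \<beta>"
begin

private abbreviation (input) "\<Delta> y \<equiv> 2 * u x - u (x - y) - u (x + y)"

private lemma measurable_lebesgue_ingredients [measurable]:
  "h \<in> borel_measurable lebesgue" "Q \<in> borel_measurable lebesgue" "norm \<in> borel_measurable (lebesgue :: 'a measure)"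
  "(\<lambda>y. u (x + y)) \<in> borel_measurable lebesgue" "(\<lambda>y. u (x - y)) \<in> borel_measurable lebesgue"
  "(\<lambda>y. reg_kernel (real DIM('a)) s \<epsilon> (norm y)) \<in> borel_measurable (lebesgue :: 'a measure)"
  using h Qm measurable_shift_lebesgue[OF u, of x]
  by (auto simp: bounded_angular_def intro!: measurable_completion)

private lemma AE_h: "AE y in lebesgue. \<bar>h y\<bar> \<le> Lam"
  using h by (simp add: bounded_angular_def)

private lemma abs_second_difference_le: "\<bar>\<Delta> y\<bar> \<le> 4 * M"
  using uM[of x] uM[of "x + y"] uM[of "x - y"] by linarith

text \<open>Inside the ball the second difference is of order \<open>(norm y)\<^sup>2\<close> plus
  \<open>norm y powr \<beta>\<close>, and both gain enough on the singularity because
  \<open>s < 1\<close> and \<open>2 * s < \<beta>\<close>. Outside it is bounded by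
  \<open>4 * M\<close> and the kernel decays integrably.\<close>

lemma integrable_singular:
  "integrable lebesgue (\<lambda>y. \<Delta> y * h y * norm y powr (- real DIM('a) - 2 * s))"
proof -
  have "integrable lebesgue (\<lambda>y::'a. indicator (ball 0 \<epsilon>) y * norm y powr q)" if "- real DIM('a) < q" for q
    using powr_norm_near_0[where 'a='a] that \<epsilon> by (auto simp: has_bochner_integral_iff)
  then have "integrable lebesgue (\<lambda>y::'a. Lam * B * (indicator (ball 0 \<epsilon>) y * norm y powr (2 - real DIM('a) - 2 * s))
      + Lam * C\<^sub>1 * (indicator (ball 0 \<epsilon>) y * norm y powr (\<beta> - real DIM('a) - 2 * s))
      + Lam * (4 * M) * (indicator (- ball 0 \<epsilon>) y * norm y powr (- real DIM('a) - 2 * s)))"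
    using s \<beta> \<epsilon> by (intro Bochner_Integration.integrable_add integrable_mult_right integrable_powr_norm_at_infinity) auto
  then show ?thesis
  proof (rule Bochner_Integration.integrable_bound)
    show "AE y in lebesgue. norm (\<Delta> y * h y * norm y powr (- real DIM('a) - 2 * s)) \<le> norm (
        Lam * B * (indicator (ball 0 \<epsilon>) y * norm y powr (2 - real DIM('a) - 2 * s))
      + Lam * C\<^sub>1 * (indicator (ball 0 \<epsilon>) y * norm y powr (\<beta> - real DIM('a) - 2 * s))
      + Lam * (4 * M) * (indicator (- ball 0 \<epsilon>) y * norm y powr (- real DIM('a) - 2 * s)))"
      using AE_h
    proof eventually_elim
      case (elim y)
      let ?p = "norm y powr (- real DIM('a) - 2 * s)"
      have "\<bar>\<Delta> y * h y * ?p\<bar> \<le> (indicator (ball 0 \<epsilon>) y * (B * (norm y)\<^sup>2 + C\<^sub>1 * norm y powr \<beta>)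
          + indicator (- ball 0 \<epsilon>) y * (4 * M)) * Lam * ?p"
        unfolding abs_mult
      proof (intro mult_mono)
        show "\<bar>\<Delta> y\<bar> \<le> indicator (ball 0 \<epsilon>) y * (B * (norm y)\<^sup>2 + C\<^sub>1 * norm y powr \<beta>)
          + indicator (- ball 0 \<epsilon>) y * (4 * M)"
          using near[of y] QB[of y] abs_second_difference_le[of y] by (auto simp: indicator_def)
        then show nn: "0 \<le> indicator (ball 0 \<epsilon>) y * (B * (norm y)\<^sup>2 + C\<^sub>1 * norm y powr \<beta>)
          + indicator (- ball 0 \<epsilon>) y * (4 * M)"
          by (rule order_trans[OF abs_ge_zero])
        show "0 \<le> (indicator (ball 0 \<epsilon>) y * (B * (norm y)\<^sup>2 + C\<^sub>1 * norm y powr \<beta>)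
          + indicator (- ball 0 \<epsilon>) y * (4 * M)) * Lam"
          using nn Lam by (rule mult_nonneg_nonneg)
      qed (use elim in auto)
      also have "\<dots> = Lam * B * (indicator (ball 0 \<epsilon>) y * norm y powr (2 - real DIM('a) - 2 * s))
      + Lam * C\<^sub>1 * (indicator (ball 0 \<epsilon>) y * norm y powr (\<beta> - real DIM('a) - 2 * s))
      + Lam * (4 * M) * (indicator (- ball 0 \<epsilon>) y * norm y powr (- real DIM('a) - 2 * s))"
      proof (cases "y = 0")
        case False
        then have "(norm y)\<^sup>2 * ?p = norm y powr ((- real DIM('a) - 2 * s) + real 2)"
          by (subst powr_mult_power[symmetric]) (auto simp: mult.commute)
        moreover have "norm y powr \<beta> * ?p = norm y powr (\<beta> + (- real DIM('a) - 2 * s))"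
          by (simp only: powr_add)
        ultimately have pw: "norm y powr (2 - real DIM('a) - 2 * s) = (norm y)\<^sup>2 * ?p"
          "norm y powr (\<beta> - real DIM('a) - 2 * s) = norm y powr \<beta> * ?p"
          by (simp_all add: algebra_simps)
        have "(i * (B * n + C\<^sub>1 * b) + j * m) * Lam * p = Lam * B * (i * (n * p)) + Lam * C\<^sub>1 * (i * (b * p)) + Lam * m * (j * p)"
          for i j n b m p :: real
          by (simp add: algebra_simps)
        then show ?thesis unfolding pw .
      qed simp
      finally show ?case unfolding real_norm_def by (rule order_trans[OF _ abs_ge_self])
    qed
  qed measurable
qed

lemma integrable_regular:
  "integrable lebesgue (\<lambda>y. \<Delta> y * h y * reg_kernel (real DIM('a)) s \<epsilon> (norm y))"
proof -
  have "integrable lebesgue (\<lambda>y::'a. indicator (ball 0 \<epsilon>) y * (4 * M * Lam * (reg_bound (real DIM('a)) s * \<epsilon> powr (- real DIM('a) - 2 * s)))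
      + Lam * (4 * M) * (indicator (- ball 0 \<epsilon>) y * norm y powr (- real DIM('a) - 2 * s)))"
    using s \<epsilon> emeasure_lborel_ball_finite[of "0::'a" \<epsilon>]
    by (intro Bochner_Integration.integrable_add integrable_mult_right integrable_mult_left
        integrable_powr_norm_at_infinity) auto
  then show ?thesis
  proof (rule Bochner_Integration.integrable_bound)
    show "AE y in lebesgue. norm (\<Delta> y * h y * reg_kernel (real DIM('a)) s \<epsilon> (norm y)) \<le> norm (
        indicator (ball 0 \<epsilon>) y * (4 * M * Lam * (reg_bound (real DIM('a)) s * \<epsilon> powr (- real DIM('a) - 2 * s)))
      + Lam * (4 * M) * (indicator (- ball 0 \<epsilon>) y * norm y powr (- real DIM('a) - 2 * s)))"
      using AE_h
    proof eventually_elim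
      case (elim y)
      have K: "\<bar>reg_kernel (real DIM('a)) s \<epsilon> (norm y)\<bar> \<le> indicator (ball 0 \<epsilon>) y * (reg_bound (real DIM('a)) s * \<epsilon> powr (- real DIM('a) - 2 * s))
          + indicator (- ball 0 \<epsilon>) y * norm y powr (- real DIM('a) - 2 * s)"
        using abs_reg_kernel_le[of "real DIM('a)" s "norm y" \<epsilon>] s by (auto simp: indicator_def reg_kernel_def)
      have "\<bar>\<Delta> y * h y * reg_kernel (real DIM('a)) s \<epsilon> (norm y)\<bar> \<le> 4 * M * Lam * (
          indicator (ball 0 \<epsilon>) y * (reg_bound (real DIM('a)) s * \<epsilon> powr (- real DIM('a) - 2 * s))
          + indicator (- ball 0 \<epsilon>) y * norm y powr (- real DIM('a) - 2 * s))"
        unfolding abs_mult using elim K abs_second_difference_le[of y] uM[of x] Lam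
        by (intro mult_mono) auto
      then show ?case by (simp add: algebra_simps)
    qed
  qed measurable
qed

text \<open>After substituting \<open>x - y\<close> for \<open>y\<close>, the integral equals its
  reflection in \<open>y\<close> because \<open>h\<close> is even; half the sum of the two contains
  the second difference. The truncation makes the first differences integrable, which justifies
  adding the integrals.\<close>

lemma integral_truncated:
  assumes "0 < r"
  shows "(LINT y:{y. r < norm (x - y)}|lebesgue. (u x - u y) / norm (x - y) powr (real DIM('a) + 2 * s) * h (x - y)) =
    1 / 2 * (LINT y|lebesgue. indicator {y. r < norm y} y * (\<Delta> y * h y * norm y powr (- real DIM('a) - 2 * s)))"
proof -
  let ?f = "\<lambda>y. indicator {y. r < norm y} y * ((u x - u (x - y)) * h y * norm y powr (- real DIM('a) - 2 * s))"
  have ind: "{y::'a. r < norm y} \<in> sets lebesgue"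
    by (intro sets_completionI_sets) simp
  note [measurable] = ind
  have fm: "?f \<in> borel_measurable lebesgue" by measurable
  have int: "integrable lebesgue ?f"
  proof (rule Bochner_Integration.integrable_bound)
    show "integrable lebesgue (\<lambda>y. Lam * (2 * M) * (indicator (- ball (0::'a) r) y * norm y powr (- real DIM('a) - 2 * s)))"
      using s assms by (intro integrable_mult_right integrable_powr_norm_at_infinity) auto
    show "AE y in lebesgue. norm (?f y) \<le> norm (Lam * (2 * M) * (indicator (- ball (0::'a) r) y * norm y powr (- real DIM('a) - 2 * s)))"
      using AE_h
    proof eventually_elim
      case (elim y)
      have "\<bar>(u x - u (x - y)) * h y * norm y powr (- real DIM('a) - 2 * s)\<bar> \<le> 2 * M * Lam * norm y powr (- real DIM('a) - 2 * s)"
        unfolding abs_mult using elim uM[of x] uM[of "x - y"] by (intro mult_mono) auto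
      then show ?case using uM[of x] Lam by (auto simp: indicator_def abs_mult mult_ac)
    qed
  qed (rule fm)
  have minus_p: "norm y powr (- real DIM('a) - 2 * s) = inverse (norm y powr (real DIM('a) + 2 * s))" for y :: 'a
    by (simp flip: powr_minus)
  have "(LINT y:{y. r < norm (x - y)}|lebesgue. (u x - u y) / norm (x - y) powr (real DIM('a) + 2 * s) * h (x - y)) =
      (LINT y|lebesgue. ?f (x + (-1) *\<^sub>R y))"
    unfolding set_lebesgue_integral_def
    by (intro Bochner_Integration.integral_cong) (auto simp: indicator_def minus_p divide_inverse)
  also have "\<dots> = (LINT y|lebesgue. ?f y)"
    by (rule integral_lebesgue_reflect_shift[symmetric, OF _ fm]) simp
  finally have 1: "(LINT y:{y. r < norm (x - y)}|lebesgue. (u x - u y) / norm (x - y) powr (real DIM('a) + 2 * s) * h (x - y)) =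
      (LINT y|lebesgue. ?f y)" .
  have 2: "(LINT y|lebesgue. ?f y) = (LINT y|lebesgue. ?f (0 + (-1) *\<^sub>R y))"
    by (rule integral_lebesgue_reflect_shift[OF _ fm]) simp
  have int': "integrable lebesgue (\<lambda>y. ?f (0 + (-1) *\<^sub>R y))"
    using integrable_lebesgue_reflect_shift[OF _ fm, of "-1" 0] int by simp
  have "(LINT y|lebesgue. ?f y) + (LINT y|lebesgue. ?f (0 + (-1) *\<^sub>R y)) =
      (LINT y|lebesgue. ?f y + ?f (0 + (-1) *\<^sub>R y))"
    by (rule Bochner_Integration.integral_add[symmetric, OF int int'])
  also have "\<dots> = (LINT y|lebesgue. indicator {y. r < norm y} y * (\<Delta> y * h y * norm y powr (- real DIM('a) - 2 * s)))"
    by (intro Bochner_Integration.integral_cong) (auto simp: indicator_def h_even algebra_simps)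
  finally show ?thesis using 1 2 by simp
qed

text \<open>The symmetrised integrand is absolutely integrable and dominates its own truncations, so
  the principal value is an ordinary integral.\<close>

lemma L_op_eq:
  assumes "h = (\<lambda>y. \<eta> (y /\<^sub>R norm y))"
  shows "L_op s \<eta> u x = 1 / 2 * (LINT y|lebesgue. \<Delta> y * h y * norm y powr (- real DIM('a) - 2 * s))"
proof -
  let ?G = "\<lambda>y. \<Delta> y * h y * norm y powr (- real DIM('a) - 2 * s)"
  let ?T = "\<lambda>r. LINT y:{y. r < norm (x - y)}|lebesgue. (u x - u y) / norm (x - y) powr (real DIM('a) + 2 * s) * h (x - y)"
  have "(?T \<longlongrightarrow> 1 / 2 * (LINT y|lebesgue. ?G y)) (at_right 0)"
  \<comment> \<open>Dominated convergence speaks of sequences, so the limit is tested along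
    sequences tending to 0 from the right; the upper end 1 is arbitrary.\<close>
  proof (rule tendsto_at_right_sequentially[OF zero_less_one])
    fix X :: "nat \<Rightarrow> real" assume X: "\<And>n. 0 < X n" "X \<longlonglongrightarrow> 0"
    have "(\<lambda>n. LINT y|lebesgue. indicator {y. X n < norm y} y * ?G y) \<longlonglongrightarrow> (LINT y|lebesgue. ?G y)"
    proof (rule integral_dominated_convergence)
      show "integrable lebesgue (\<lambda>y. norm (?G y))" using integrable_singular by (rule integrable_norm)
      show "?G \<in> borel_measurable lebesgue" by measurable
      show "(\<lambda>y. indicator {y. X n < norm y} y * ?G y) \<in> borel_measurable lebesgue" for n
      proof -
        have [measurable]: "{y::'a. X n < norm y} \<in> sets lebesgue"
          by (intro sets_completionI_sets) simp
        show ?thesis by measurable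
      qed
      show "AE y in lebesgue. (\<lambda>n. indicator {y. X n < norm y} y * ?G y) \<longlonglongrightarrow> ?G y"
      proof (rule AE_I2)
        fix y :: 'a
        show "(\<lambda>n. indicator {y. X n < norm y} y * ?G y) \<longlonglongrightarrow> ?G y"
        proof (cases "y = 0")
          case False
          then have "\<forall>\<^sub>F n in sequentially. X n < norm y"
            using order_tendstoD(2)[OF X(2)] by simp
          then have "\<forall>\<^sub>F n in sequentially. indicator {y. X n < norm y} y * ?G y = ?G y"
            by eventually_elim simp
          then show ?thesis by (rule tendsto_eventually)
        qed simp
      qed
      show "AE y in lebesgue. norm (indicator {y. X n < norm y} y * ?G y) \<le> norm (?G y)" for n
        by (intro AE_I2) (auto simp: indicator_def)
    qed
    then show "(\<lambda>n. ?T (X n)) \<longlonglongrightarrow> 1 / 2 * (LINT y|lebesgue. ?G y)"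
      unfolding integral_truncated[OF X(1)] by (intro tendsto_mult_left)
  qed
  then have "Lim (at_right 0) ?T = 1 / 2 * (LINT y|lebesgue. ?G y)"
    by (intro tendsto_Lim) auto
  then show ?thesis by (simp add: L_op_def assms)
qed

lemma L_op_diff_eq:
  assumes "h = (\<lambda>y. \<eta> (y /\<^sub>R norm y))"
  shows "L_op s \<eta> u x - L_eps_op s \<epsilon> \<eta> u x =
    1 / 2 * (LINT y|lebesgue. indicator (ball 0 \<epsilon>) y *
       (\<Delta> y * h y * (norm y powr (- real DIM('a) - 2 * s) - reg_kernel (real DIM('a)) s \<epsilon> (norm y))))"
    and "integrable lebesgue (\<lambda>y. indicator (ball 0 \<epsilon>) y *
       (\<Delta> y * h y * (norm y powr (- real DIM('a) - 2 * s) - reg_kernel (real DIM('a)) s \<epsilon> (norm y))))"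
proof -
  have eq: "\<Delta> y * h y * norm y powr (- real DIM('a) - 2 * s) - \<Delta> y * h y * reg_kernel (real DIM('a)) s \<epsilon> (norm y) =
      indicator (ball 0 \<epsilon>) y * (\<Delta> y * h y * (norm y powr (- real DIM('a) - 2 * s) - reg_kernel (real DIM('a)) s \<epsilon> (norm y)))" for y
    by (auto simp: indicator_def reg_kernel_def algebra_simps)
  have "L_op s \<eta> u x - L_eps_op s \<epsilon> \<eta> u x =
    1 / 2 * ((LINT y|lebesgue. \<Delta> y * h y * norm y powr (- real DIM('a) - 2 * s))
       - (LINT y|lebesgue. \<Delta> y * h y * reg_kernel (real DIM('a)) s \<epsilon> (norm y)))"
    unfolding L_op_eq[OF assms] L_eps_op_def by (simp add: assms right_diff_distrib)
  then show "L_op s \<eta> u x - L_eps_op s \<epsilon> \<eta> u x =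
    1 / 2 * (LINT y|lebesgue. indicator (ball 0 \<epsilon>) y *
       (\<Delta> y * h y * (norm y powr (- real DIM('a) - 2 * s) - reg_kernel (real DIM('a)) s \<epsilon> (norm y))))"
    using Bochner_Integration.integral_diff[OF integrable_singular integrable_regular] by (simp only: eq)
  show "integrable lebesgue (\<lambda>y. indicator (ball 0 \<epsilon>) y *
       (\<Delta> y * h y * (norm y powr (- real DIM('a) - 2 * s) - reg_kernel (real DIM('a)) s \<epsilon> (norm y))))"
    using Bochner_Integration.integrable_diff[OF integrable_singular integrable_regular] by (simp only: eq)
qed

text \<open>Dividing \<open>Q\<close> by \<open>(norm y)\<^sup>2\<close> leaves a bounded function
  of degree zero, so its product with \<open>h\<close> is an admissible angular part.\<close>

lemma quadratic_part_vanishes: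
  "has_bochner_integral lebesgue (\<lambda>y. indicator (ball 0 \<epsilon>) y *
     (Q y * h y * (norm y powr (- real DIM('a) - 2 * s) - reg_kernel (real DIM('a)) s \<epsilon> (norm y)))) 0"
proof -
  let ?k = "\<lambda>y. h y * (Q y / (norm y)\<^sup>2)"
  have "bounded_angular ?k (Lam * B)"
    unfolding bounded_angular_def
  proof (intro conjI allI impI)
    show "?k \<in> borel_measurable lebesgue" by measurable
    show "?k (t *\<^sub>R y) = ?k y" if "0 < t" for t y
      using h that by (simp add: bounded_angular_def Qhom power_mult_distrib)
    show "AE y in lebesgue. \<bar>?k y\<bar> \<le> Lam * B"
      using AE_h
    proof eventually_elim
      case (elim y)
      \<comment> \<open>Tested on a basis vector. Nonnegativity of \<open>B\<close> is what the
        bound says at \<open>y = 0\<close>, where the quotient is 0 by convention.\<close>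
      have "0 \<le> B * 1" using QB[of "SOME b. b \<in> Basis"] by (simp add: norm_Basis some_in_eq)
      then have "\<bar>Q y / (norm y)\<^sup>2\<bar> \<le> B"
        using QB[of y] by (cases "y = 0") (auto simp: divide_le_eq)
      then show ?case unfolding abs_mult using elim Lam by (intro mult_mono) auto
    qed
  qed
  from angular_reg_kernel_moment[OF this s \<epsilon>]
  have "has_bochner_integral lebesgue (\<lambda>y. ?k y * (indicator (ball 0 \<epsilon>) y *
    ((norm y)\<^sup>2 * (norm y powr (- real DIM('a) - 2 * s) - reg_kernel (real DIM('a)) s \<epsilon> (norm y))))) 0" .
  moreover have "?k y * (indicator (ball 0 \<epsilon>) y *
    ((norm y)\<^sup>2 * (norm y powr (- real DIM('a) - 2 * s) - reg_kernel (real DIM('a)) s \<epsilon> (norm y)))) = indicator (ball 0 \<epsilon>) y *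
     (Q y * h y * (norm y powr (- real DIM('a) - 2 * s) - reg_kernel (real DIM('a)) s \<epsilon> (norm y)))" for y
    using QB[of y] by (cases "y = 0") auto
  ultimately show ?thesis by simp
qed

text \<open>Adding the vanishing integral of \<open>Q\<close> replaces the second difference by its
  Taylor remainder. The terms with denominators \<open>\<beta> - 2 * s\<close> and
  \<open>d + \<beta>\<close> come from the singular and the regularised kernel. The bound
  \<open>B\<close> on \<open>Q\<close> does not enter the estimate.\<close>

lemma abs_L_op_diff_le:
  assumes h_eq: "h = (\<lambda>y. \<eta> (y /\<^sub>R norm y))"
    and c: "\<And>q R::real. - real DIM('a) < q \<Longrightarrow> 0 \<le> R \<Longrightarrow>
    has_bochner_integral lebesgue (\<lambda>y::'a. indicator (ball 0 R) y * norm y powr q)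
      (c * (R powr (real DIM('a) + q) / (real DIM('a) + q)))"
  shows "\<bar>L_op s \<eta> u x - L_eps_op s \<epsilon> \<eta> u x\<bar> \<le>
    1 / 2 * (C\<^sub>1 * Lam * (c * (1 / (\<beta> - 2 * s) + reg_bound (real DIM('a)) s / (real DIM('a) + \<beta>)) * \<epsilon> powr (\<beta> - 2 * s)))"
proof -
  let ?K = "\<lambda>y::'a. norm y powr (- real DIM('a) - 2 * s) - reg_kernel (real DIM('a)) s \<epsilon> (norm y)"
  let ?F = "\<lambda>y. indicator (ball 0 \<epsilon>) y * (\<Delta> y * h y * ?K y)"
  let ?G = "\<lambda>y. indicator (ball 0 \<epsilon>) y * (Q y * h y * ?K y)"
  let ?H = "\<lambda>y::'a. C\<^sub>1 * Lam * (indicator (ball 0 \<epsilon>) y * norm y powr (\<beta> - real DIM('a) - 2 * s)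
      + reg_bound (real DIM('a)) s * \<epsilon> powr (- real DIM('a) - 2 * s) * (indicator (ball 0 \<epsilon>) y * norm y powr \<beta>))"
  have \<beta>_less: "- real DIM('a) < \<beta>" using s \<beta> of_nat_0_le_iff[of "DIM('a)", where 'a=real] by linarith
  have "has_bochner_integral lebesgue ?H (C\<^sub>1 * Lam * (c * (\<epsilon> powr (real DIM('a) + (\<beta> - real DIM('a) - 2 * s)) / (real DIM('a) + (\<beta> - real DIM('a) - 2 * s)))
      + reg_bound (real DIM('a)) s * \<epsilon> powr (- real DIM('a) - 2 * s) * (c * (\<epsilon> powr (real DIM('a) + \<beta>) / (real DIM('a) + \<beta>)))))"
    using \<beta> \<epsilon> \<beta>_less by (intro has_bochner_integral_mult_right has_bochner_integral_add c) auto
  moreover have pw: "\<epsilon> powr (- real DIM('a) - 2 * s) * (\<epsilon> powr (real DIM('a) + \<beta>)) = \<epsilon> powr (\<beta> - 2 * s)"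
    by (simp add: powr_add[symmetric])
  moreover have "c * (\<epsilon> powr (real DIM('a) + (\<beta> - real DIM('a) - 2 * s)) / (real DIM('a) + (\<beta> - real DIM('a) - 2 * s)))
      + reg_bound (real DIM('a)) s * \<epsilon> powr (- real DIM('a) - 2 * s) * (c * (\<epsilon> powr (real DIM('a) + \<beta>) / (real DIM('a) + \<beta>)))
    = c * (1 / (\<beta> - 2 * s) + reg_bound (real DIM('a)) s / (real DIM('a) + \<beta>)) * \<epsilon> powr (\<beta> - 2 * s)"
  proof -
    have "c * (e / b) + r * p * (c * (q / D)) = c * (1 / b + r / D) * e" if "p * q = e" for e b r p q D :: real
      unfolding that[symmetric] by (simp add: algebra_simps)
    from this[OF pw] show ?thesis by simp
  qed
  ultimately have H: "has_bochner_integral lebesgue ?H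
      (C\<^sub>1 * Lam * (c * (1 / (\<beta> - 2 * s) + reg_bound (real DIM('a)) s / (real DIM('a) + \<beta>)) * \<epsilon> powr (\<beta> - 2 * s)))"
    by (simp only:)
  note F = L_op_diff_eq[OF h_eq]
  have G: "integrable lebesgue ?G" "(LINT y|lebesgue. ?G y) = 0"
    using quadratic_part_vanishes unfolding has_bochner_integral_iff by (rule conjunct1, rule conjunct2)
  \<comment> \<open>The operators use the second difference with the sign opposite to that in
    \<open>near\<close>; hence \<open>Q\<close> is added here.\<close>
  have F_eq: "(LINT y|lebesgue. ?F y) = (LINT y|lebesgue. ?F y + ?G y)"
    unfolding Bochner_Integration.integral_add[OF F(2) G(1)] G(2) add_0_right by (rule refl)
  have le_H: "\<bar>LINT y|lebesgue. ?F y + ?G y\<bar> \<le> (LINT y|lebesgue. ?H y)"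
    unfolding real_norm_def[symmetric]
  proof (rule order_trans[OF integral_norm_bound integral_mono_AE])
    show "integrable lebesgue (\<lambda>y. norm (?F y + ?G y))"
      by (intro integrable_norm Bochner_Integration.integrable_add F(2) G(1))
    show "integrable lebesgue ?H" using H unfolding has_bochner_integral_iff by (rule conjunct1)
    show "AE y in lebesgue. norm (?F y + ?G y) \<le> ?H y"
      using AE_h
    proof eventually_elim
      case (elim y)
      show ?case
      proof (cases "y \<in> ball 0 \<epsilon>")
        case True
        have "\<bar>?K y\<bar> \<le> norm y powr (- real DIM('a) - 2 * s) + reg_bound (real DIM('a)) s * \<epsilon> powr (- real DIM('a) - 2 * s)"
          by (rule order_trans[OF abs_triangle_ineq4])
            (use abs_reg_kernel_le[of "real DIM('a)" s "norm y" \<epsilon>] s True in simp)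
        moreover have "\<bar>\<Delta> y + Q y\<bar> \<le> C\<^sub>1 * norm y powr \<beta>"
          using near[of y] True by simp
        ultimately have "\<bar>(\<Delta> y + Q y) * h y * ?K y\<bar> \<le>
            C\<^sub>1 * norm y powr \<beta> * Lam * (norm y powr (- real DIM('a) - 2 * s) + reg_bound (real DIM('a)) s * \<epsilon> powr (- real DIM('a) - 2 * s))"
          unfolding abs_mult using elim C\<^sub>1 Lam by (intro mult_mono) auto
        also have "\<dots> = C\<^sub>1 * Lam * (norm y powr \<beta> * norm y powr (- real DIM('a) - 2 * s)
            + reg_bound (real DIM('a)) s * \<epsilon> powr (- real DIM('a) - 2 * s) * norm y powr \<beta>)"
          by (simp add: algebra_simps)
        also have "norm y powr \<beta> * norm y powr (- real DIM('a) - 2 * s) = norm y powr (\<beta> - real DIM('a) - 2 * s)"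
          by (simp only: powr_add[symmetric]) (simp add: algebra_simps)
        finally have le: "\<bar>(\<Delta> y + Q y) * h y * ?K y\<bar> \<le> C\<^sub>1 * Lam * (norm y powr (\<beta> - real DIM('a) - 2 * s)
            + reg_bound (real DIM('a)) s * \<epsilon> powr (- real DIM('a) - 2 * s) * norm y powr \<beta>)" .
        have ind: "indicator (ball 0 \<epsilon>) y = (1::real)" using True by simp
        show ?thesis
          using le unfolding ind real_norm_def mult_1 distrib_right .
      qed simp
    qed
  qed
  note le = le_H[folded F_eq, unfolded has_bochner_integral_integral_eq[OF H]]
  have "\<bar>1 / 2 * a\<bar> \<le> 1 / 2 * b" if "\<bar>a\<bar> \<le> b" for a b :: real
    using that by simp
  from this[OF le] show ?thesis unfolding F(1) .
qed

end

section \<open>The class of weighted Hoelder functions\<close>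

lemma holder_norm_leD:
  fixes f :: "'a::euclidean_space \<Rightarrow> real"
  defines "k \<equiv> \<lambda>\<beta>::real. nat \<lfloor>\<beta>\<rfloor>"
  assumes "holder_norm \<beta> D f \<le> ennreal H" "0 \<le> H"
  shows holder_norm_partials_le: "j \<le> k \<beta> \<Longrightarrow> bs \<in> multi_indices j \<Longrightarrow> x \<in> D \<Longrightarrow> \<bar>partials bs f x\<bar> \<le> H"
    and holder_norm_diff_le: "bs \<in> multi_indices (k \<beta>) \<Longrightarrow> x \<in> D \<Longrightarrow> y \<in> D \<Longrightarrow>
      \<bar>partials bs f x - partials bs f y\<bar> \<le> H * dist x y powr frac \<beta>"
proof -
  let ?S = "\<lambda>j. SUP bs\<in>multi_indices j. SUP x\<in>D. ennreal \<bar>partials bs f x\<bar>"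
  let ?N = "SUP bs\<in>multi_indices (k \<beta>). holder_seminorm (frac \<beta>) D (partials bs f)"
  have sum: "(\<Sum>j\<le>k \<beta>. ?S j) + ?N \<le> ennreal H"
    using assms(2) by (simp add: holder_norm_def k_def Let_def)
  show "\<bar>partials bs f x\<bar> \<le> H" if "j \<le> k \<beta>" "bs \<in> multi_indices j" "x \<in> D"
  proof -
    have "ennreal \<bar>partials bs f x\<bar> \<le> ?S j"
      using that by (intro SUP_upper2[of bs] SUP_upper2[of x]) auto
    also have "\<dots> \<le> (\<Sum>j\<le>k \<beta>. ?S j)"
      using that by (intro member_le_sum) auto
    also have "\<dots> \<le> (\<Sum>j\<le>k \<beta>. ?S j) + ?N" by simp
    also note sum
    finally show ?thesis using \<open>0 \<le> H\<close> by simp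
  qed
  show "\<bar>partials bs f x - partials bs f y\<bar> \<le> H * dist x y powr frac \<beta>"
    if "bs \<in> multi_indices (k \<beta>)" "x \<in> D" "y \<in> D"
  proof (cases "x = y")
    case False
    have "ennreal (\<bar>partials bs f x - partials bs f y\<bar> / dist x y powr frac \<beta>)
        \<le> holder_seminorm (frac \<beta>) D (partials bs f)"
      unfolding holder_seminorm_def using that False
      by (intro SUP_upper2[of x] SUP_upper2[of y]) auto
    also have "\<dots> \<le> ?N"
      using that by (intro SUP_upper2[of bs]) auto
    also have "\<dots> \<le> (\<Sum>j\<le>k \<beta>. ?S j) + ?N" by simp
    also note sum
    finally show ?thesis using \<open>0 \<le> H\<close> False by (simp add: divide_le_eq)
  qed (use \<open>0 \<le> H\<close> in auto)
qed

lemma Nil_multi_indices_0: "[] \<in> multi_indices 0"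
  by (simp add: multi_indices_def)

lemma holder_norm_less_1:
  fixes w :: "'a::euclidean_space \<Rightarrow> real"
  assumes "0 < s" "s < 1" "holder_norm s D w \<le> ennreal M" "0 \<le> M"
  shows "x \<in> D \<Longrightarrow> \<bar>w x\<bar> \<le> M" and "continuous_on D w"
proof -
  have s: "nat \<lfloor>s\<rfloor> = 0" "frac s = s" using assms by (simp_all add: frac_eq floor_eq_iff)
  note le = holder_norm_partials_le[OF assms(3,4)] holder_norm_diff_le[OF assms(3,4)]
  show "\<bar>w x\<bar> \<le> M" if "x \<in> D"
    using le(1)[OF _ Nil_multi_indices_0 that] by simp
  have diff: "\<bar>w x - w y\<bar> \<le> M * dist x y powr s" if "x \<in> D" "y \<in> D" for x y
    using le(2)[of "[]" x y] that Nil_multi_indices_0 s by simp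
  show "continuous_on D w"
    unfolding continuous_on_def
  proof
    fix x assume x: "x \<in> D"
    have "((\<lambda>y. M * dist y x powr s) \<longlongrightarrow> M * 0 powr s) (at x within D)"
      using \<open>0 < s\<close> by (intro tendsto_mult_left tendsto_powr' tendsto_dist_iff[THEN iffD1] tendsto_ident_at
          tendsto_const) auto
    then have "((\<lambda>y. M * dist y x powr s) \<longlongrightarrow> 0) (at x within D)" by simp
    moreover have "\<forall>\<^sub>F y in at x within D. norm (w y - w x) \<le> M * dist y x powr s"
      using diff[OF _ x] by (auto simp: eventually_at_filter)
    ultimately have "((\<lambda>y. w y - w x) \<longlongrightarrow> 0) (at x within D)"
      by (rule Lim_null_comparison[rotated])
    then show "(w \<longlongrightarrow> w x) (at x within D)" by (rule LIM_zero_cancel)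
  qed
qed

text \<open>A ball is connected, so if it met both \<open>S\<close> and the complement it would
  contain a frontier point too close to \<open>x\<close>. For an empty frontier
  \<open>infdist\<close> is 0 and the ball is empty.\<close>

lemma ball_infdist_frontier_subset:
  fixes x :: "'a::euclidean_space"
  assumes "x \<in> S"
  shows "ball x (infdist x (frontier S)) \<subseteq> S"
proof (rule ccontr)
  assume "\<not> ?thesis"
  moreover from this have "0 < infdist x (frontier S)"
    by (metis ball_eq_empty empty_subsetI not_le)
  then have "x \<in> ball x (infdist x (frontier S)) \<inter> S" using assms by simp
  ultimately have "ball x (infdist x (frontier S)) \<inter> S \<noteq> {}" "ball x (infdist x (frontier S)) - S \<noteq> {}"
    by blast+
  from connected_Int_frontier[OF connected_ball this]
  obtain z where "z \<in> frontier S" "dist x z < infdist x (frontier S)" by auto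
  then show False using infdist_le[of z "frontier S" x] by simp
qed

section \<open>Homogeneity, measurability and size of directional derivatives in the
  direction\<close>

lemma prod_list_inner_scaleR:
  fixes y :: "'a::real_inner"
  shows "(\<Prod>b\<leftarrow>bs. (t *\<^sub>R y) \<bullet> b) = t ^ length bs * (\<Prod>b\<leftarrow>bs. y \<bullet> b)"
  by (induction bs) (simp_all add: mult_ac)

lemma dir_deriv_scaleR: "dir_deriv j f (t *\<^sub>R y) z = t ^ j * dir_deriv j f y z"
  unfolding dir_deriv_def sum_distrib_left prod_list_inner_scaleR
  by (rule sum.cong) (auto simp: multi_indices_def)

lemma borel_measurable_dir_deriv: "(\<lambda>y. dir_deriv j f y z) \<in> borel_measurable borel"
proof -
  have "(\<lambda>y. \<Prod>b\<leftarrow>bs. y \<bullet> b) \<in> borel_measurable borel" for bs :: "'a list"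
    by (induction bs) auto
  then show ?thesis unfolding dir_deriv_def by (intro borel_measurable_sum borel_measurable_times) auto
qed

lemma abs_dir_deriv_le:
  "\<bar>dir_deriv j f y z\<bar> \<le> (\<Sum>bs\<in>multi_indices j. \<bar>partials bs f z\<bar>) * norm y ^ j"
  unfolding dir_deriv_def sum_distrib_right
proof (rule sum_abs[THEN order_trans], rule sum_mono)
  fix bs :: "'a list" assume "bs \<in> multi_indices j"
  then have "\<bar>\<Prod>b\<leftarrow>bs. y \<bullet> b\<bar> \<le> norm y ^ j"
    using abs_prod_list_inner_le[of bs y] by (auto simp: multi_indices_def)
  then show "\<bar>(\<Prod>b\<leftarrow>bs. y \<bullet> b) * partials bs f z\<bar> \<le> \<bar>partials bs f z\<bar> * norm y ^ j"
    by (metis abs_ge_zero abs_mult mult.commute mult_left_mono)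
qed

text \<open>Every point of the ball keeps a fixed fraction of the boundary distance of its centre,
  so the weighted Hoelder bound holds there with one constant of order
  \<open>bdist \<Omega> x powr (s - \<beta>)\<close>.\<close>

lemma S_class_second_difference:
  fixes \<Omega> :: "'a::euclidean_space set"
  defines "k \<equiv> \<lambda>\<beta>::real. nat \<lfloor>\<beta>\<rfloor>"
  assumes w: "w \<in> S_class s \<beta> M \<Omega>" and \<beta>: "0 \<le> \<beta>" "\<beta> < 4" and "1 < \<alpha>" "0 < \<epsilon>"
    and x: "x \<in> \<Omega>" and \<delta>: "\<alpha> * \<epsilon> \<le> bdist \<Omega> x" and y: "norm y < \<epsilon>"
  shows "\<bar>w (x + y) + w (x - y) - 2 * w x - (if 2 \<le> k \<beta> then dir_deriv 2 w y x else 0)\<bar>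
         \<le> 2 * real DIM('a) ^ k \<beta> * (M * ((1 - 1 / \<alpha>) * bdist \<Omega> x) powr (s - \<beta>)) * norm y powr \<beta>"
    and "ball x \<epsilon> \<subseteq> \<Omega>"
proof -
  \<comment> \<open>From \<open>\<epsilon> \<le> bdist \<Omega> x / \<alpha>\<close> and the
    triangle inequality, this is a lower bound for the boundary distance on the ball; it is positive
    because \<open>1 < \<alpha>\<close>.\<close>
  define \<rho> where "\<rho> = (1 - 1 / \<alpha>) * bdist \<Omega> x"
  have "\<epsilon> < \<alpha> * \<epsilon>" using \<open>1 < \<alpha>\<close> \<open>0 < \<epsilon>\<close> by simp
  then have less: "\<epsilon> < bdist \<Omega> x" using \<delta> by linarith
  then have "0 < \<rho>" using \<open>1 < \<alpha>\<close> \<open>0 < \<epsilon>\<close> by (simp add: \<rho>_def)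
  \<comment> \<open>The closed ball is required because \<open>holder_loc\<close> speaks of open
    sets whose closure is compact and contained in the domain.\<close>
  have cball: "cball x \<epsilon> \<subseteq> \<Omega>"
    using ball_infdist_frontier_subset[OF x] less by (auto simp: subset_iff)
  then show "ball x \<epsilon> \<subseteq> \<Omega>" by auto
  have "\<epsilon> \<le> bdist \<Omega> x / \<alpha>" using \<delta> \<open>1 < \<alpha>\<close> by (simp add: field_simps)
  then have \<rho>_le: "\<rho> \<le> bdist \<Omega> x - \<epsilon>" by (simp add: \<rho>_def algebra_simps)
  have D: "ball x \<epsilon> \<subseteq> {z \<in> \<Omega>. \<rho> \<le> bdist \<Omega> z}"
  proof
    fix z assume z: "z \<in> ball x \<epsilon>"
    have "bdist \<Omega> x \<le> bdist \<Omega> z + dist x z" by (rule infdist_triangle)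
    then show "z \<in> {z \<in> \<Omega>. \<rho> \<le> bdist \<Omega> z}" using z \<rho>_le cball by auto
  qed
  have "0 \<le> M" and Ck: "Ck_on (k \<beta>) (ball x \<epsilon>) w"
    and H: "holder_norm \<beta> {z \<in> \<Omega>. \<rho> \<le> bdist \<Omega> z} w \<le> ennreal (M * \<rho> powr (s - \<beta>))"
    using w cball \<open>0 < \<epsilon>\<close> \<open>0 < \<rho>\<close> by (auto simp: S_class_def holder_loc_def k_def)
  have "0 \<le> M * \<rho> powr (s - \<beta>)" using \<open>0 \<le> M\<close> by simp
  note diff = holder_norm_diff_le[OF H this]
  have "x \<in> ball x \<epsilon>" using \<open>0 < \<epsilon>\<close> by simp
  show "\<bar>w (x + y) + w (x - y) - 2 * w x - (if 2 \<le> k \<beta> then dir_deriv 2 w y x else 0)\<bar>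
         \<le> 2 * real DIM('a) ^ k \<beta> * (M * ((1 - 1 / \<alpha>) * bdist \<Omega> x) powr (s - \<beta>)) * norm y powr \<beta>"
    unfolding k_def \<rho>_def[symmetric]
    by (rule holder_second_difference[OF \<beta> Ck[unfolded k_def] \<open>0 \<le> M * _\<close> _ y], rule diff)
      (use D subsetD[OF D \<open>x \<in> ball x \<epsilon>\<close>] in auto)
qed

theorem theorem3p1:
  fixes s \<beta> lam Lam M \<alpha>\<^sub>0 :: real
  assumes "0 < s" and "s < 1"
    and "2 * s < \<beta>" and "\<beta> \<le> 4" and "\<beta> \<notin> \<nat>" and "\<beta> - 2 * s \<notin> \<nat>"
    and "0 < lam" and "lam \<le> Lam"
    and "1 < \<alpha>\<^sub>0"
  shows "\<exists>C::real. \<forall>(\<Omega> :: 'a::euclidean_space set) \<eta> w \<epsilon> x.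
     bounded_lipschitz_domain \<Omega> \<longrightarrow> exterior_ball_condition \<Omega> \<longrightarrow>
     \<eta> \<in> kernel_class lam Lam \<longrightarrow> w \<in> S_class s \<beta> M \<Omega> \<longrightarrow>
     0 < \<epsilon> \<longrightarrow> x \<in> \<Omega> \<longrightarrow> \<alpha>\<^sub>0 * \<epsilon> \<le> bdist \<Omega> x \<longrightarrow>
     \<bar>L_op s \<eta> (zero_ext \<Omega> w) x - L_eps_op s \<epsilon> \<eta> (zero_ext \<Omega> w) x\<bar>
       \<le> C * \<epsilon> powr (\<beta> - 2 * s) * bdist \<Omega> x powr (s - \<beta>)"
proof -
  \<comment> \<open>The end point 4 is a natural number and hence excluded, so at most three
    derivatives occur.\<close>
  have \<beta>: "0 \<le> \<beta>" "\<beta> < 4"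
  proof -
    have "(4::real) \<in> \<nat>" by simp
    then show "\<beta> < 4" using assms by (metis less_eq_real_def)
  qed (use assms in auto)
  define k where "k = nat \<lfloor>\<beta>\<rfloor>"
  obtain c where c: "\<And>q R::real. - real DIM('a) < q \<Longrightarrow> 0 \<le> R \<Longrightarrow>
    has_bochner_integral lebesgue (\<lambda>y::'a. indicator (ball 0 R) y * norm y powr q)
      (c * (R powr (real DIM('a) + q) / (real DIM('a) + q)))"
    using powr_norm_near_0[where 'a='a] by auto
  \<comment> \<open>The factor 1/2 of the operators cancels the 2 of the second difference. The
    power of \<open>1 - 1 / \<alpha>\<^sub>0\<close> is split off from the radius on which the
    Hoelder bound is used.\<close>
  define C where "C = real DIM('a) ^ k * M * (1 - 1 / \<alpha>\<^sub>0) powr (s - \<beta>) * Lam *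
      (c * (1 / (\<beta> - 2 * s) + reg_bound (real DIM('a)) s / (real DIM('a) + \<beta>)))"
  show ?thesis
  proof (intro exI[of _ C] allI impI)
    fix \<Omega> :: "'a set" and \<eta> w :: "'a \<Rightarrow> real" and \<epsilon> :: real and x :: 'a
    assume \<Omega>: "bounded_lipschitz_domain \<Omega>" and \<eta>: "\<eta> \<in> kernel_class lam Lam" and w: "w \<in> S_class s \<beta> M \<Omega>"
      and \<epsilon>: "0 < \<epsilon>" and x: "x \<in> \<Omega>" and \<delta>: "\<alpha>\<^sub>0 * \<epsilon> \<le> bdist \<Omega> x"
    have "open \<Omega>" using \<Omega> by (simp add: bounded_lipschitz_domain_def)
    have "0 \<le> M" and M: "holder_norm s (closure \<Omega>) w \<le> ennreal M"
      using w by (auto simp: S_class_def)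
    define u where "u = zero_ext \<Omega> w"
    define C\<^sub>1 where "C\<^sub>1 = 2 * real DIM('a) ^ k * (M * ((1 - 1 / \<alpha>\<^sub>0) * bdist \<Omega> x) powr (s - \<beta>))"
    define Q where "Q y = (if 2 \<le> k then dir_deriv 2 w y x else 0)" for y
    \<comment> \<open>Continuity of \<open>w\<close> on the open set makes the extension by zero
      Borel measurable, although it may jump at the boundary.\<close>
    have u_cont: "continuous_on \<Omega> w"
      using holder_norm_less_1(2)[OF assms(1,2) M \<open>0 \<le> M\<close>] closure_subset by (rule continuous_on_subset)
    have "(\<lambda>z. indicator \<Omega> z *\<^sub>R w z) \<in> borel_measurable borel"
      using borel_measurable_continuous_on_indicator[OF _ u_cont] \<open>open \<Omega>\<close> by auto
    moreover have "(\<lambda>z. indicator \<Omega> z *\<^sub>R w z) = u"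
      by (auto simp: u_def zero_ext_def)
    ultimately have u: "u \<in> borel_measurable borel" by simp
    have uM: "\<bar>u z\<bar> \<le> M" for z
      using holder_norm_less_1(1)[OF assms(1,2) M \<open>0 \<le> M\<close>, of z] \<open>0 \<le> M\<close> closure_subset
      by (auto simp: u_def zero_ext_def)
    have near: "\<bar>u (x + y) + u (x - y) - 2 * u x - Q y\<bar> \<le> C\<^sub>1 * norm y powr \<beta>" if "norm y < \<epsilon>" for y
    proof -
      note diff = S_class_second_difference[OF w \<beta> \<open>1 < \<alpha>\<^sub>0\<close> \<epsilon> x \<delta> that]
      have "x + y \<in> \<Omega>" "x - y \<in> \<Omega>"
        by (rule subsetD[OF diff(2)], simp add: dist_norm that)+
      then show ?thesis
        using diff x by (auto simp: u_def zero_ext_def C\<^sub>1_def Q_def k_def)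
    qed
    have "\<bar>L_op s \<eta> u x - L_eps_op s \<epsilon> \<eta> u x\<bar> \<le> 1 / 2 * (C\<^sub>1 * Lam *
        (c * (1 / (\<beta> - 2 * s) + reg_bound (real DIM('a)) s / (real DIM('a) + \<beta>)) * \<epsilon> powr (\<beta> - 2 * s)))"
    proof (rule abs_L_op_diff_le[where h="\<lambda>y. \<eta> (y /\<^sub>R norm y)" and Q=Q and
          B="\<Sum>bs\<in>multi_indices 2. \<bar>partials bs w x\<bar>" and M=M])
      show "bounded_angular (\<lambda>y. \<eta> (y /\<^sub>R norm y)) Lam"
        and "\<And>y. \<eta> ((- y) /\<^sub>R norm (- y)) = \<eta> (y /\<^sub>R norm y)"
        using kernel_class_bounded_angular[OF \<eta>] assms by auto
      show "Q \<in> borel_measurable borel"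
        using borel_measurable_dir_deriv[of 2 w x] by (simp add: Q_def[abs_def])
      show "Q (t *\<^sub>R y) = t\<^sup>2 * Q y" for t y by (simp add: Q_def dir_deriv_scaleR)
      show "\<bar>Q y\<bar> \<le> (\<Sum>bs\<in>multi_indices 2. \<bar>partials bs w x\<bar>) * (norm y)\<^sup>2" for y
        using abs_dir_deriv_le[of 2 w y x] by (auto simp: Q_def intro!: mult_nonneg_nonneg sum_nonneg)
      show "0 \<le> C\<^sub>1" using \<open>0 \<le> M\<close> by (simp add: C\<^sub>1_def)
    qed (use assms \<epsilon> u uM near c in auto)
    also have "\<dots> = C * \<epsilon> powr (\<beta> - 2 * s) * bdist \<Omega> x powr (s - \<beta>)"
      using assms by (simp add: C_def C\<^sub>1_def powr_mult infdist_nonneg mult_ac)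
    finally show "\<bar>L_op s \<eta> (zero_ext \<Omega> w) x - L_eps_op s \<epsilon> \<eta> (zero_ext \<Omega> w) x\<bar>
       \<le> C * \<epsilon> powr (\<beta> - 2 * s) * bdist \<Omega> x powr (s - \<beta>)"
      unfolding u_def .
  qed
qed

end
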